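(* Let $d\ge 1$ be an integer and let $\Delta=\operatorname{conv}(v_1,\ldots,v_{2d})\subset\mathbb{R}^{2d-1}$ be a $(2d-1)$-dimensional lattice simplex (with respect to $\mathbb{Z}^{2d-1}$) all of whose codimension-$1$ facets are basic lattice simplices. Then the following statements are equivalent: (1) for all $k=1,\ldots,d-1$ there are no lattice points in the interior of $k\Delta$, i.e. $\mathrm{Int}(k\Delta)\cap\mathbb{Z}^{2d-1}=\emptyset$; (2) $\Delta\cong\Delta_1*\cdots*\Delta_d$ for some $1$-dimensional lattice simplices (lattice segments) $\Delta_1,\ldots,\Delta_d\subset\mathbb{R}^d$.
   Context: A $k$-dimensional lattice simplex $\operatorname{conv}(w_1,\ldots,w_{k+1})\subset\mathbb{R}^m$ (vertices in $\mathbb{Z}^m$, affinely independent) is called basic if $w_1-w_{k+1},\ldots,w_k-w_{k+1}$ is part of a lattice basis of $\mathbb{Z}^m$ (equivalently, it is mapped onto $\operatorname{conv}(0,e_1,\ldots,e_k)$ by an affine unimodular isomorphism of $\mathbb{R}^m$). Cayley polytope: for lattice polytopes $\Sigma_1,\ldots,\Sigma_r\subset\mathbb{R}^d$ ($r\le d$), $\Sigma_1*\cdots*\Sigma_r$ is the convex hull of $e_1\times\Sigma_1,\ldots,e_r\times\Sigma_r$ in $\mathbb{R}^{r+d}=\mathbb{R}^r\times\mathbb{R}^d$, where $e_i$ are the standard basis vectors of $\mathbb{R}^r$; it lies in the affine hyperplane $H=\{x\in\mathbb{R}^{r+d}:x_1+\cdots+x_r=1\}$, which carries the affine lattice $H\cap\mathbb{Z}^{r+d}$.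 Here $\Delta\cong P$ for $P\subset H$ (with $r=d$, so $H$ has dimension $2d-1$) means there is an affine isomorphism $\varphi:\mathbb{R}^{2d-1}\to H$ with $\varphi(\mathbb{Z}^{2d-1})=H\cap\mathbb{Z}^{2d}$ and $\varphi(\Delta)=P$. *)

theory Defs
  imports "HOL-Analysis.Analysis"
begin

text \<open>Taking the coordinates with respect to \<^const>\<open>Basis\<close> covers both the lattice of integer
  points of \<open>real ^ 'n\<close> and that of products such as \<open>(real ^ 'r) \<times> (real ^ 'd)\<close>.\<close>

definition integer_lattice :: "'a::euclidean_space set" where
  "integer_lattice = {x. \<forall>b\<in>Basis. x \<bullet> b \<in> \<int>}"

lemma integer_lattice_vec_iff:
  fixes x :: "real ^ 'n"
  shows "x \<in> integer_lattice \<longleftrightarrow> (\<forall>i. x $ i \<in> \<int>)"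
  by (auto simp: integer_lattice_def Basis_vec_def inner_axis)

lemma integer_lattice_prod_eq:
  "(integer_lattice :: ('a::euclidean_space \<times> 'b::euclidean_space) set)
     = integer_lattice \<times> integer_lattice"
  by (auto simp: integer_lattice_def Basis_prod_def ball_Un)

definition lattice_basis :: "'a::euclidean_space set \<Rightarrow> bool" where
  "lattice_basis B \<longleftrightarrow>
     independent B \<and>
     {\<Sum>b\<in>B. of_int (c b) *\<^sub>R b | c :: 'a \<Rightarrow> int. True} = integer_lattice"

definition lattice_simplex :: "nat \<Rightarrow> 'a::euclidean_space set \<Rightarrow> bool" where
  "lattice_simplex k S \<longleftrightarrow>
     (\<exists>W. W \<subseteq> integer_lattice \<and> \<not> affine_dependent W \<and> card W = k + 1 \<and> S = convex hull W)"

text \<open>The vertex \<open>w\<close> plays the role of the last vertex \<open>w\<^bsub>k+1\<^esub>\<close>; the notion does not depend on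
  which vertex is singled out.\<close>

definition basic_simplex :: "'a::euclidean_space set \<Rightarrow> bool" where
  "basic_simplex S \<longleftrightarrow>
     (\<exists>W w. W \<subseteq> integer_lattice \<and> \<not> affine_dependent W \<and> w \<in> W \<and> S = convex hull W \<and>
        (\<exists>B. lattice_basis B \<and> (\<lambda>u. u - w) ` (W - {w}) \<subseteq> B))"

definition cayley_polytope ::
  "('r::finite \<Rightarrow> 'a::euclidean_space set) \<Rightarrow> ((real ^ 'r) \<times> 'a) set" where
  "cayley_polytope \<Sigma> = convex hull (\<Union>i. {axis i 1} \<times> \<Sigma> i)"

definition cayley_hyperplane :: "((real ^ 'r::finite) \<times> 'a::euclidean_space) set" where
  "cayley_hyperplane = {(x, y). (\<Sum>i\<in>UNIV. x $ i) = 1}"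

definition affine_map :: "('a::real_vector \<Rightarrow> 'b::real_vector) \<Rightarrow> bool" where
  "affine_map f \<longleftrightarrow> (\<exists>L c. linear L \<and> (\<forall>x. f x = L x + c))"

definition cayley_isomorphic ::
  "'b::euclidean_space set \<Rightarrow> ((real ^ 'r::finite) \<times> 'a::euclidean_space) set \<Rightarrow> bool" where
  "cayley_isomorphic S P \<longleftrightarrow>
     (\<exists>\<phi>. affine_map \<phi> \<and> bij_betw \<phi> UNIV cayley_hyperplane \<and>
        \<phi> ` integer_lattice = cayley_hyperplane \<inter> integer_lattice \<and> \<phi> ` S = P)"

end

theory Submission
  imports Defs "HOL-Number_Theory.Residues" "HOL-Number_Theory.Modular_Inverse"
    "HOL-Computational_Algebra.Nth_Powers"
begin

text \<open>Since all facets are basic, the lattice points modulo the lattice spanned by the vertices form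
  a cyclic group, generated in barycentric coordinates by \<open>(a v / N)\<close> with every \<open>a v\<close> prime to
  \<open>N\<close>. As \<open>j\<close> and \<open>- j\<close> have complementary fractional parts, the absence of interior lattice points
  in the dilates up to \<open>d - 1\<close> says exactly that the fractional parts of \<open>j * a v / N\<close> sum to
  \<open>d\<close> for all \<open>j\<close> not divisible by \<open>N\<close>. This forces the residues \<open>a v\<close> to cancel in pairs:
  otherwise the difference of the counts of \<open>x\<close> and \<open>- x\<close> generates, under dilation by units, an
  odd character \<open>\<chi>\<close> modulo \<open>N\<close> orthogonal to all sawtooth functions, and the finite Fourier
  transform together with the partial fractions of the cotangent gives \<open>L(1, cnj \<chi>) = 0\<close>,
  contradicting Dirichlet. Each pair of vertices becomes one segment of the Cayley polytope.
  Conversely, at an interior point of the \<open>k\<close>-th dilate of a Cayley polytope the first \<open>d\<close>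
  coordinates are positive with sum \<open>k\<close>, so such a point can be integral only if \<open>k \<ge> d\<close>.\<close>

section \<open>Summation by parts\<close>

lemma sum_by_parts:
  fixes f :: "nat \<Rightarrow> 'a::real_vector" and b :: "nat \<Rightarrow> real"
  shows "(\<Sum>k<n. b k *\<^sub>R f k) = (\<Sum>k<n. (b k - b (Suc k)) *\<^sub>R sum f {..k}) + b n *\<^sub>R sum f {..<n}"
  by (induction n) (auto simp: algebra_simps lessThan_Suc_atMost[symmetric])

lemma norm_sum_by_parts_le:
  fixes f :: "nat \<Rightarrow> 'a::real_normed_vector" and b :: "nat \<Rightarrow> real"
  shows "norm (\<Sum>k<n. b k *\<^sub>R f k)
    \<le> (\<Sum>k<n. \<bar>b k - b (Suc k)\<bar> * norm (sum f {..k})) + \<bar>b n\<bar> * norm (sum f {..<n})"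
proof -
  have "norm (\<Sum>k<n. b k *\<^sub>R f k)
      \<le> norm (\<Sum>k<n. (b k - b (Suc k)) *\<^sub>R sum f {..k}) + norm (b n *\<^sub>R sum f {..<n})"
    by (subst sum_by_parts) (rule norm_triangle_ineq)
  moreover have "norm (\<Sum>k<n. (b k - b (Suc k)) *\<^sub>R sum f {..k})
      \<le> (\<Sum>k<n. \<bar>b k - b (Suc k)\<bar> * norm (sum f {..k}))"
    by (rule order_trans[OF norm_sum]) simp
  ultimately show ?thesis by simp
qed

lemma norm_sum_decseq_le:
  fixes f :: "nat \<Rightarrow> 'a::real_normed_vector" and b :: "nat \<Rightarrow> real"
  assumes bound: "\<And>n. norm (sum f {..<n}) \<le> C" and "decseq b" and nonneg: "\<And>n. b n \<ge> 0"
  shows "norm (\<Sum>k<n. b k *\<^sub>R f k) \<le> C * b 0"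
proof -
  have dec: "b (Suc k) \<le> b k" for k using \<open>decseq b\<close> by (simp add: decseq_Suc_iff)
  have "norm (\<Sum>k<n. b k *\<^sub>R f k)
      \<le> (\<Sum>k<n. \<bar>b k - b (Suc k)\<bar> * norm (sum f {..k})) + \<bar>b n\<bar> * norm (sum f {..<n})"
    by (rule norm_sum_by_parts_le)
  also have "\<dots> \<le> (\<Sum>k<n. (b k - b (Suc k)) * C) + b n * C"
    using dec nonneg bound bound[of "Suc _"]
    by (intro add_mono sum_mono) (simp_all add: mult_left_mono lessThan_Suc_atMost)
  also have "\<dots> = C * b 0"
    unfolding sum_distrib_right[symmetric] sum_lessThan_telescope' by (simp add: algebra_simps)
  finally show ?thesis .
qed

lemma norm_sum_decseq_tail_le:
  fixes f :: "nat \<Rightarrow> 'a::real_normed_vector" and b :: "nat \<Rightarrow> real"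
  assumes bound: "\<And>n. norm (sum f {..<n}) \<le> C" and "decseq b" and nonneg: "\<And>n. b n \<ge> 0"
  shows "norm (\<Sum>k=m..<n. b k *\<^sub>R f k) \<le> 2 * C * b m"
proof -
  have "norm (\<Sum>k<l. f (m + k)) \<le> 2 * C" for l
  proof -
    have "sum f {..<m + l} = sum f {..<m} + (\<Sum>k<l. f (m + k))"
      by (induction l) (auto simp: algebra_simps)
    then have "(\<Sum>k<l. f (m + k)) = sum f {..<m + l} - sum f {..<m}" by simp
    also have "norm \<dots> \<le> norm (sum f {..<m + l}) + norm (sum f {..<m})" by (rule norm_triangle_ineq4)
    finally show ?thesis using bound[of "m + l"] bound[of m] by simp
  qed
  moreover have "decseq (\<lambda>k. b (m + k))" using \<open>decseq b\<close> by (simp add: decseq_def)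
  ultimately have "norm (\<Sum>k<n - m. b (m + k) *\<^sub>R f (m + k)) \<le> 2 * C * b m"
    using norm_sum_decseq_le[of "\<lambda>k. f (m + k)" "2 * C" "\<lambda>k. b (m + k)" "n - m"] nonneg by simp
  then show ?thesis
    by (simp add: sum.atLeastLessThan_shift_0[of _ m n] atLeast0LessThan add.commute)
qed

lemma summable_decseq_scaleR:
  fixes f :: "nat \<Rightarrow> 'a::banach" and b :: "nat \<Rightarrow> real"
  assumes bound: "\<And>n. norm (sum f {..<n}) \<le> C" and "decseq b" and "b \<longlonglongrightarrow> 0"
  shows "summable (\<lambda>k. b k *\<^sub>R f k)"
  unfolding summable_Cauchy
proof (intro allI impI)
  fix \<epsilon> :: real assume "\<epsilon> > 0"
  have nonneg: "b n \<ge> 0" for n using decseq_ge[OF assms(2,3)] .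
  have "(\<lambda>n. 2 * C * b n) \<longlonglongrightarrow> 2 * C * 0" by (intro tendsto_intros \<open>b \<longlonglongrightarrow> 0\<close>)
  then have "eventually (\<lambda>n. 2 * C * b n < \<epsilon>) sequentially"
    using \<open>\<epsilon> > 0\<close> by (intro order_tendstoD(2)) auto
  then obtain M where "\<And>m. m \<ge> M \<Longrightarrow> 2 * C * b m < \<epsilon>" by (auto simp: eventually_sequentially)
  then show "\<exists>M. \<forall>m\<ge>M. \<forall>n. norm (\<Sum>k = m..<n. b k *\<^sub>R f k) < \<epsilon>"
    using norm_sum_decseq_tail_le[OF bound \<open>decseq b\<close> nonneg] by (meson le_less_trans)
qed

section \<open>Dirichlet characters\<close>

lemma euler_theorem_int:
  assumes "coprime x (int N)" "N > 0"
  shows "[x ^ totient N = 1] (mod int N)"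
proof -
  define r where "r = nat (x mod int N)"
  have r: "[int r = x] (mod int N)" using assms(2) by (simp add: r_def cong_def)
  then have "coprime (int r) (int N)" using assms(1) cong_imp_coprime cong_sym by blast
  then have "[r ^ totient N = 1] (mod N)" by (intro euler_theorem) simp
  then have "[int r ^ totient N = 1] (mod int N)" by (simp flip: cong_int_iff)
  then show ?thesis using cong_pow[OF r] cong_sym cong_trans by blast
qed

lemma bij_betw_mult_residues:
  fixes m n :: int
  assumes "coprime m n" "n > 0"
  shows "bij_betw (\<lambda>x. m * x mod n) {0..<n} {0..<n}"
proof -
  have "bij_betw (\<lambda>x. m * x mod n) ({1..<n} \<union> {0}) ({1..<n} \<union> {0})"
    using bij_betw_int_remainders_mult[OF assms(1)] by (rule bij_betw_combine) auto
  moreover have "{1..<n} \<union> {0} = {0..<n}" using assms(2) by auto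
  ultimately show ?thesis by simp
qed

lemma sum_residues_nat: "(\<Sum>x\<in>{0..<int N}. f x) = (\<Sum>x<N. f (int x))"
  by (rule sum.reindex_bij_witness[of _ int nat]) auto

locale dirichlet_character =
  fixes N :: nat and chi :: "int \<Rightarrow> complex"
  assumes N_pos: "N > 0"
    and chi_1: "chi 1 = 1"
    and chi_mult: "chi (x * y) = chi x * chi y"
    and chi_mod: "chi (x mod int N) = chi x"
    and chi_eq_0: "\<not> coprime x (int N) \<Longrightarrow> chi x = 0"
begin

lemma chi_cong: "[x = y] (mod int N) \<Longrightarrow> chi x = chi y"
  by (metis chi_mod cong_def)

lemma chi_power: "chi (x ^ k) = chi x ^ k"
  by (induction k) (simp_all add: chi_1 chi_mult)

lemma norm_chi:
  assumes "coprime x (int N)"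
  shows "norm (chi x) = 1"
proof -
  have "chi x ^ totient N = 1"
    using chi_cong[OF euler_theorem_int[OF assms N_pos]] by (simp add: chi_power chi_1)
  then have "norm (chi x) ^ totient N = 1" by (metis norm_one norm_power)
  moreover have "totient N > 0" using N_pos by simp
  ultimately show ?thesis by (metis norm_ge_zero power_eq_imp_eq_base power_one zero_le_one)
qed

lemma norm_chi_le: "norm (chi x) \<le> 1"
  using norm_chi[of x] chi_eq_0[of x] by (cases "coprime x (int N)") auto

lemma dirichlet_character_square: "dirichlet_character N (\<lambda>x. chi x ^ 2)"
  by unfold_locales (simp_all add: N_pos chi_1 chi_mult chi_mod chi_eq_0 power_mult_distrib)

lemma dirichlet_character_cnj: "dirichlet_character N (\<lambda>x. cnj (chi x))"
  by unfold_locales (simp_all add: N_pos chi_1 chi_mult chi_mod chi_eq_0)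

end

locale nonprincipal_character = dirichlet_character +
  assumes nonprincipal: "\<exists>m. coprime m (int N) \<and> chi m \<noteq> 1"
begin

lemma N_gt_1: "N > 1"
proof (rule ccontr)
  assume "\<not> N > 1"
  then have "N = 1" using N_pos by simp
  then show False using nonprincipal chi_cong[of _ 1] chi_1 by auto
qed

lemma chi_zero: "chi 0 = 0"
  using chi_eq_0[of 0] N_gt_1 by simp

lemma sum_residues_eq_0: "(\<Sum>x\<in>{0..<int N}. chi x) = 0"
proof -
  obtain m where m: "coprime m (int N)" "chi m \<noteq> 1" using nonprincipal by blast
  have "(\<Sum>x\<in>{0..<int N}. chi x) = (\<Sum>x\<in>{0..<int N}. chi (m * x mod int N))"
    using sum.reindex_bij_betw[OF bij_betw_mult_residues[OF m(1)], of chi] N_pos by simp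
  also have "\<dots> = chi m * (\<Sum>x\<in>{0..<int N}. chi x)"
    by (simp add: chi_mod chi_mult sum_distrib_left)
  finally show ?thesis using m(2) by (simp add: mult_cancel_right1)
qed

lemma norm_partial_sum_le: "norm (\<Sum>x<n. chi (int x)) \<le> N"
proof -
  have block: "(\<Sum>x=q * N..<q * N + N. chi (int x)) = 0" for q
  proof -
    have "chi (int (x + q * N)) = chi (int x)" for x
      by (rule chi_cong) (simp add: cong_def)
    then have "(\<Sum>x=q * N..<q * N + N. chi (int x)) = (\<Sum>x<N. chi (int x))"
      by (simp add: sum.atLeastLessThan_shift_0[of _ "q * N"] atLeast0LessThan add.commute)
    then show ?thesis using sum_residues_eq_0 by (simp add: sum_residues_nat)
  qed
  have "(\<Sum>x<n. chi (int x)) = (\<Sum>x<(n div N) * N. chi (int x)) + (\<Sum>x=(n div N) * N..<n. chi (int x))"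
    using sum.atLeastLessThan_concat[of 0 "n div N * N" n "\<lambda>x. chi (int x)"]
    by (simp add: lessThan_atLeast0)
  also have "(\<Sum>x<(n div N) * N. chi (int x)) = 0"
    unfolding sum.nat_group[symmetric] block by simp
  also have "norm (0 + (\<Sum>x=(n div N) * N..<n. chi (int x))) \<le> (\<Sum>x=(n div N) * N..<n. 1)"
    unfolding add_0 by (intro order_trans[OF norm_sum] sum_mono norm_chi_le)
  also have "\<dots> \<le> N" using N_pos by (simp add: minus_div_mult_eq_mod less_imp_le)
  finally show ?thesis .
qed

lemma norm_partial_sum_Suc_le: "norm (\<Sum>k<n. chi (int (Suc k))) \<le> N"
  using norm_partial_sum_le[of "Suc n"] unfolding sum.lessThan_Suc_shift by (simp add: chi_zero)

end

locale odd_character = dirichlet_character +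
  assumes odd: "chi (-1) = -1"

sublocale odd_character \<subseteq> nonprincipal_character
  by unfold_locales (rule exI[of _ "-1"], simp add: odd)

context odd_character
begin

lemma chi_minus: "chi (- x) = - chi x"
  using chi_mult[of "-1" x] odd by simp

lemma odd_character_cnj: "odd_character N (\<lambda>x. cnj (chi x))"
  using dirichlet_character_cnj by (simp add: odd_character_def odd_character_axioms_def odd)

end

section \<open>Euler products\<close>

definition rough :: "nat \<Rightarrow> nat set" where
  "rough P = {n. n > 0 \<and> (\<forall>p. prime p \<longrightarrow> p dvd n \<longrightarrow> P \<le> p)}"

lemma rough_Suc_subset: "rough (Suc P) \<subseteq> rough P"
  by (auto simp: rough_def)

lemma rough_Suc_eq_if_not_prime: "\<not> prime P \<Longrightarrow> rough (Suc P) = rough P"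
  by (auto simp: rough_def Suc_le_eq le_less)

lemma rough_diff_rough_Suc:
  assumes "prime P"
  shows "rough P - rough (Suc P) = (*) P ` rough P"
proof (intro equalityI subsetI)
  fix n assume n: "n \<in> rough P - rough (Suc P)"
  then obtain p where p: "prime p" "p dvd n" "P \<le> p" "\<not> Suc P \<le> p" by (auto simp: rough_def)
  then have "p = P" by simp
  with p obtain k where "n = P * k" by auto
  moreover from this n have "k \<in> rough P" by (auto simp: rough_def)
  ultimately show "n \<in> (*) P ` rough P" by blast
next
  fix n assume "n \<in> (*) P ` rough P"
  then obtain k where k: "n = P * k" "k \<in> rough P" by blast
  then have "P \<le> p" if "prime p" "p dvd n" for p
    using that assms by (auto simp: rough_def prime_dvd_mult_iff dest: primes_dvd_imp_eq)
  moreover have "n > 0" using k assms by (auto simp: rough_def prime_gt_0_nat)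
  ultimately show "n \<in> rough P - rough (Suc P)" using k assms by (auto simp: rough_def)
qed

lemma infsum_rough:
  fixes f :: "nat \<Rightarrow> 'a::{real_normed_field, banach}"
  assumes abs_summable: "(\<lambda>n. norm (f n)) summable_on UNIV"
    and mult: "\<And>m n. f (m * n) = f m * f n" and "f 0 = 0"
  shows "infsum f (rough P) = infsum f UNIV * (\<Prod>p | prime p \<and> p < P. 1 - f p)"
proof (induction P)
  case 0
  have "infsum f (rough 0) = infsum f UNIV"
    by (rule infsum_cong_neutral) (use \<open>f 0 = 0\<close> in \<open>auto simp: rough_def\<close>)
  then show ?case by simp
next
  case (Suc P)
  have summable: "f summable_on A" for A
    using abs_summable abs_summable_summable summable_on_subset_banach by blast
  show ?case
  proof (cases "prime P")
    case False
    then have "{p. prime p \<and> p < Suc P} = {p. prime p \<and> p < P}" by (auto simp: less_Suc_eq)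
    then show ?thesis using Suc False by (simp add: rough_Suc_eq_if_not_prime)
  next
    case True
    have "infsum f (rough P) - infsum f (rough (Suc P)) = infsum f ((*) P ` rough P)"
      by (simp add: infsum_Diff summable rough_Suc_subset flip: rough_diff_rough_Suc[OF True])
    also have "\<dots> = infsum (\<lambda>k. f P * f k) (rough P)"
      using True by (subst infsum_reindex) (auto simp: inj_on_def o_def mult prime_gt_0_nat)
    also have "\<dots> = f P * infsum f (rough P)" by (rule infsum_cmult_right) (use summable in auto)
    finally have "infsum f (rough (Suc P)) = (1 - f P) * infsum f (rough P)"
      by (simp add: algebra_simps)
    moreover have "{p. prime p \<and> p < Suc P} = insert P {p. prime p \<and> p < P}"
      using True by (auto simp: less_Suc_eq)
    ultimately show ?thesis using Suc by simp
  qed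
qed

lemma tendsto_infsum_atLeast:
  fixes f :: "nat \<Rightarrow> 'a::banach"
  assumes "f summable_on UNIV"
  shows "(\<lambda>P. infsum f {P..}) \<longlonglongrightarrow> 0"
proof -
  have tail_eq: "infsum f {P..} = infsum f UNIV - sum f {..<P}" for P
  proof -
    have "infsum f (UNIV - {..<P}) = infsum f UNIV - infsum f {..<P}"
      using assms by (intro infsum_Diff) auto
    moreover have "UNIV - {..<P} = {P..}" by auto
    ultimately show ?thesis by simp
  qed
  have "(\<lambda>P. sum f {..<P}) \<longlonglongrightarrow> infsum f UNIV"
    using has_sum_imp_sums[OF has_sum_infsum[OF assms]] by (simp add: sums_def)
  from tendsto_diff[OF tendsto_const[of "infsum f UNIV"] this]
  have "(\<lambda>P. infsum f UNIV - sum f {..<P}) \<longlonglongrightarrow> 0" by simp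
  with tail_eq show ?thesis by simp
qed

lemma tendsto_infsum_rough:
  fixes f :: "nat \<Rightarrow> 'a::banach"
  assumes abs_summable: "(\<lambda>n. norm (f n)) summable_on UNIV"
  shows "(\<lambda>P. infsum f (rough P)) \<longlonglongrightarrow> f 1"
proof -
  have summable: "f summable_on A" "(\<lambda>n. norm (f n)) summable_on A" for A
    using abs_summable abs_summable_summable summable_on_subset_banach by blast+
  have "norm (infsum f (rough P) - f 1) \<le> infsum (\<lambda>n. norm (f n)) {P..}" for P
  proof -
    have "1 \<in> rough P" by (auto simp: rough_def)
    then have "infsum f (rough P) - f 1 = infsum f (rough P - {1})"
      by (subst infsum_Diff) (use summable in auto)
    also have "norm \<dots> \<le> infsum (\<lambda>n. norm (f n)) (rough P - {1})"
      by (rule norm_infsum_bound) (rule summable)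
    also have "\<dots> \<le> infsum (\<lambda>n. norm (f n)) {P..}"
    proof (rule infsum_mono_neutral)
      fix n assume "n \<in> rough P - {1} - {P..}"
      then have n: "n > 0" "n \<noteq> 1" "n < P" "\<And>p. prime p \<Longrightarrow> p dvd n \<Longrightarrow> P \<le> p"
        by (auto simp: rough_def)
      then obtain p where "prime p" "p dvd n" using prime_factor_nat by blast
      then have "P \<le> n" using n dvd_imp_le order_trans by blast
      then show "norm (f n) \<le> 0" using n by simp
    qed (use summable in auto)
    finally show ?thesis .
  qed
  then have "(\<lambda>P. infsum f (rough P) - f 1) \<longlonglongrightarrow> 0"
    by (intro Lim_null_comparison[OF always_eventually tendsto_infsum_atLeast[OF abs_summable]])
      blast
  then show ?thesis by (simp add: LIM_zero_iff)
qed

definition dirichlet_series :: "(int \<Rightarrow> complex) \<Rightarrow> real \<Rightarrow> complex" where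
  "dirichlet_series a s = (\<Sum>\<^sub>\<infinity>n. real n powr - s *\<^sub>R a (int n))"

definition euler_denominator :: "(int \<Rightarrow> complex) \<Rightarrow> real \<Rightarrow> nat \<Rightarrow> complex" where
  "euler_denominator a s P = (\<Prod>p | prime p \<and> p < P. 1 - real p powr - s *\<^sub>R a (int p))"

lemma abs_summable_dirichlet_series:
  fixes a :: "int \<Rightarrow> complex"
  assumes "s > 1" "\<And>x. norm (a x) \<le> 1"
  shows "(\<lambda>n. norm (real n powr - s *\<^sub>R a (int n))) summable_on UNIV"
proof -
  have "summable (\<lambda>n. real n powr - s)" using assms by (subst summable_real_powr_iff) simp
  then have "summable (\<lambda>n. norm (real n powr - s *\<^sub>R a (int n)))"
    by (rule summable_comparison_test[rotated]) (use assms in \<open>auto simp: mult_left_le\<close>)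
  then show ?thesis by (subst summable_on_UNIV_nonneg_real_iff) auto
qed

lemma dirichlet_series_sums:
  assumes "s > 1" "\<And>x. norm (a x) \<le> 1"
  shows "(\<lambda>k. real (Suc k) powr - s *\<^sub>R a (int (Suc k))) sums dirichlet_series a s"
proof -
  let ?f = "\<lambda>n. real n powr - s *\<^sub>R a (int n)"
  have "?f summable_on UNIV"
    using abs_summable_dirichlet_series[OF assms] by (rule abs_summable_summable)
  then have "?f sums dirichlet_series a s"
    unfolding dirichlet_series_def by (simp add: has_sum_imp_sums)
  then show ?thesis using sums_Suc_iff[of ?f "dirichlet_series a s"] by simp
qed

lemma tendsto_dirichlet_series_mult_euler_denominator:
  assumes "s > 1" "\<And>x. norm (a x) \<le> 1" and mult: "\<And>x y. a (x * y) = a x * a y" and "a 1 = 1"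
  shows "(\<lambda>P. dirichlet_series a s * euler_denominator a s P) \<longlonglongrightarrow> 1"
proof -
  note summable = abs_summable_dirichlet_series[of s a, OF assms(1,2)]
  from infsum_rough[OF summable] tendsto_infsum_rough[OF summable] show ?thesis
    by (simp add: dirichlet_series_def euler_denominator_def powr_mult mult \<open>a 1 = 1\<close>)
qed

lemma ln_norm_one_minus_sums:
  fixes z :: complex
  assumes "norm z < 1"
  shows "(\<lambda>n. - Re (z ^ n) / real n) sums ln (norm (1 - z))"
proof -
  have "(\<lambda>n. Re (- (z ^ n) / of_nat n)) sums Re (Ln (1 - z))"
    using sums_Re[OF Ln_series'[of "- z"]] assms by simp
  moreover have "1 - z \<noteq> 0" using assms by auto
  ultimately show ?thesis by simp
qed

text \<open>For \<open>w = q ^ n\<close> the \<open>n\<close>-th terms of the three logarithm series add up to a negative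
  multiple of \<open>3 + 4 * Re w + Re (w\<^sup>2) \<ge> 2 * (1 + Re w)\<^sup>2\<close>.\<close>

lemma norm_341_le_1:
  fixes q :: complex and r :: real
  assumes q: "norm q \<le> 1" and r: "0 \<le> r" "r < 1"
  shows "norm (1 - complex_of_real r) ^ 3 * norm (1 - r *\<^sub>R q) ^ 4 * norm (1 - r *\<^sub>R q\<^sup>2) \<le> 1"
proof -
  define x y z where "x = norm (1 - complex_of_real r)" and "y = norm (1 - r *\<^sub>R q)"
    and "z = norm (1 - r *\<^sub>R q\<^sup>2)"
  have less_1: "norm (r *\<^sub>R w) < 1" if "norm w \<le> 1" for w :: complex
    using that r mult_left_le[of "norm w" r] by simp
  have le_1: "norm (q ^ n) \<le> 1" for n using q by (simp add: norm_power power_le_one)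
  have pos: "norm (1 - r *\<^sub>R w) > 0" if "norm w \<le> 1" for w :: complex
    using less_1[OF that] by (metis less_irrefl norm_one right_minus_eq zero_less_norm_iff)
  have "x > 0" "y > 0" "z > 0"
    using pos[of 1] pos[OF q] pos[OF le_1[of 2]] by (simp_all add: x_def y_def z_def of_real_def)
  have series: "(\<lambda>n. - (r ^ n * Re (w ^ n)) / n) sums ln (norm (1 - r *\<^sub>R w))" if "norm w \<le> 1"
      for w :: complex
    using ln_norm_one_minus_sums[OF less_1[OF that]] by (simp add: scaleR_power)
  have "3 * ln x + 4 * ln y + ln z \<le> 0"
  proof (rule sums_le[OF _ _ sums_zero])
    show "(\<lambda>n. 3 * (- (r ^ n * Re (1 ^ n)) / n) + 4 * (- (r ^ n * Re (q ^ n)) / n)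
        + - (r ^ n * Re ((q\<^sup>2) ^ n)) / n) sums (3 * ln x + 4 * ln y + ln z)"
      unfolding x_def y_def z_def of_real_def by (intro sums_add sums_mult series q le_1) simp
    show "3 * (- (r ^ n * Re (1 ^ n)) / n) + 4 * (- (r ^ n * Re (q ^ n)) / n)
        + - (r ^ n * Re ((q\<^sup>2) ^ n)) / n \<le> 0" for n
    proof -
      define w where "w = q ^ n"
      have "(Re w)\<^sup>2 + (Im w)\<^sup>2 \<le> 1" using le_1[of n] by (simp add: w_def cmod_def)
      moreover have "3 + 4 * Re w + Re (w\<^sup>2) = 2 * (1 + Re w)\<^sup>2 + (1 - ((Re w)\<^sup>2 + (Im w)\<^sup>2))"
        by (simp add: power2_eq_square algebra_simps)
      moreover have "2 * (1 + Re w)\<^sup>2 \<ge> 0" by simp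
      ultimately have "3 + 4 * Re w + Re (w\<^sup>2) \<ge> 0" by linarith
      then have "0 \<le> r ^ n / n * (3 + 4 * Re w + Re (w\<^sup>2))" using r by simp
      moreover have "(q\<^sup>2) ^ n = w\<^sup>2"
        by (simp add: w_def flip: power_mult power_mult[of q n 2] mult.commute)
      ultimately show ?thesis by (simp add: w_def algebra_simps add_divide_distrib)
    qed
  qed
  moreover have "ln (x ^ 3 * y ^ 4 * z) = 3 * ln x + 4 * ln y + ln z"
    using \<open>x > 0\<close> \<open>y > 0\<close> \<open>z > 0\<close> by (simp add: ln_mult ln_realpow)
  ultimately have "ln (x ^ 3 * y ^ 4 * z) \<le> 0" by linarith
  moreover have "x ^ 3 * y ^ 4 * z > 0" using \<open>x > 0\<close> \<open>y > 0\<close> \<open>z > 0\<close> by simp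
  ultimately have "x ^ 3 * y ^ 4 * z \<le> 1" by (simp only: ln_le_zero_iff)
  then show ?thesis by (simp add: x_def y_def z_def)
qed

context dirichlet_character
begin

lemma norm_341_euler_denominator_le_1:
  assumes "s > 0"
  shows "norm (euler_denominator (\<lambda>_. 1) s P) ^ 3 * norm (euler_denominator chi s P) ^ 4
    * norm (euler_denominator (\<lambda>x. chi x ^ 2) s P) \<le> 1" (is "?lhs \<le> 1")
proof -
  have "?lhs = (\<Prod>p | prime p \<and> p < P. norm (1 - complex_of_real (real p powr - s)) ^ 3
      * norm (1 - real p powr - s *\<^sub>R chi (int p)) ^ 4
      * norm (1 - real p powr - s *\<^sub>R chi (int p) ^ 2))"
    by (simp add: euler_denominator_def prod_norm[symmetric] prod_power_distrib prod.distrib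
        of_real_def)
  also have "\<dots> \<le> 1"
  proof (intro prod_le_1 conjI norm_341_le_1 norm_chi_le)
    show "real p powr - s < 1" if "p \<in> {p. prime p \<and> p < P}" for p
      using that assms powr_less_mono[of "- s" 0 "real p"] by (auto dest: prime_gt_1_nat)
  qed auto
  finally show ?thesis .
qed

lemma norm_341_dirichlet_series_ge_1:
  assumes "s > 1"
  shows "1 \<le> norm (dirichlet_series (\<lambda>_. 1) s) ^ 3 * norm (dirichlet_series chi s) ^ 4
    * norm (dirichlet_series (\<lambda>x. chi x ^ 2) s)"
proof -
  define zeta L L2 where "zeta = dirichlet_series (\<lambda>_. 1) s" and "L = dirichlet_series chi s"
    and "L2 = dirichlet_series (\<lambda>x. chi x ^ 2) s"
  define E0 E1 E2 where "E0 = euler_denominator (\<lambda>_. 1) s" and "E1 = euler_denominator chi s"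
    and "E2 = euler_denominator (\<lambda>x. chi x ^ 2) s"
  have "(\<lambda>P. (zeta * E0 P) ^ 3 * (L * E1 P) ^ 4 * (L2 * E2 P)) \<longlonglongrightarrow> 1 ^ 3 * 1 ^ 4 * 1"
    unfolding zeta_def L_def L2_def E0_def E1_def E2_def using assms
    by (intro tendsto_intros tendsto_dirichlet_series_mult_euler_denominator)
      (auto simp: norm_power power_le_one norm_chi_le chi_mult chi_1 power_mult_distrib)
  from tendsto_norm[OF this]
  have "(\<lambda>P. norm ((zeta * E0 P) ^ 3 * (L * E1 P) ^ 4 * (L2 * E2 P))) \<longlonglongrightarrow> 1" by simp
  moreover have "norm ((zeta * E0 P) ^ 3 * (L * E1 P) ^ 4 * (L2 * E2 P))
      \<le> norm zeta ^ 3 * norm L ^ 4 * norm L2" for P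
  proof -
    have "norm (E0 P) ^ 3 * norm (E1 P) ^ 4 * norm (E2 P) \<le> 1"
      unfolding E0_def E1_def E2_def using assms by (intro norm_341_euler_denominator_le_1) simp
    then have "norm zeta ^ 3 * norm L ^ 4 * norm L2
        * (norm (E0 P) ^ 3 * norm (E1 P) ^ 4 * norm (E2 P))
        \<le> norm zeta ^ 3 * norm L ^ 4 * norm L2 * 1"
      by (intro mult_left_mono) simp_all
    then show ?thesis by (simp add: norm_mult norm_power power_mult_distrib mult_ac)
  qed
  ultimately have "1 \<le> norm zeta ^ 3 * norm L ^ 4 * norm L2" by (intro LIMSEQ_le_const2) auto
  then show ?thesis by (simp only: zeta_def L_def L2_def)
qed

end

section \<open>Nonvanishing of \<open>L(1, \<chi>)\<close> for complex characters\<close>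

lemma powr_diff_bounds:
  fixes e x :: real
  assumes "e > 0" "x > 0"
  shows "e * (x + 1) powr (- e - 1) \<le> x powr - e - (x + 1) powr - e"
    and "x powr - e - (x + 1) powr - e \<le> e * x powr (- e - 1)"
proof -
  have "\<exists>z>x. z < x + 1 \<and> (x + 1) powr - e - x powr - e = (x + 1 - x) * (- e * z powr (- e - 1))"
    using assms by (intro MVT2) (auto intro!: derivative_eq_intros simp: field_simps powr_diff)
  then obtain z where z: "x < z" "z < x + 1"
    "(x + 1) powr - e - x powr - e = - e * z powr (- e - 1)"
    by auto
  have "e * (x + 1) powr (- e - 1) \<le> e * z powr (- e - 1)"
    "e * z powr (- e - 1) \<le> e * x powr (- e - 1)"
    using z assms by (auto intro!: mult_left_mono powr_mono2')
  then show "e * (x + 1) powr (- e - 1) \<le> x powr - e - (x + 1) powr - e"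
    "x powr - e - (x + 1) powr - e \<le> e * x powr (- e - 1)"
    using z(3) by linarith+
qed

lemma powr_Suc_diff_le:
  fixes e :: real
  assumes "e > 0"
  shows "real (Suc k) powr - e - real (Suc (Suc k)) powr - e \<le> e / real (Suc k)"
proof -
  have "real (Suc k) powr - e - real (Suc (Suc k)) powr - e \<le> e * real (Suc k) powr (- e - 1)"
    using powr_diff_bounds(2)[of e "real (Suc k)"] assms by (simp add: add.commute)
  also have "\<dots> \<le> e * real (Suc k) powr - 1" using assms by (intro mult_left_mono powr_mono) auto
  finally show ?thesis by (simp add: powr_minus field_simps)
qed

lemma sum_powr_le:
  fixes s :: real
  assumes "s > 1"
  shows "(\<Sum>k<M. real (Suc k) powr - s) \<le> s / (s - 1)"
proof -
  have "(s - 1) * (\<Sum>k<M. real (Suc (Suc k)) powr - s)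
      \<le> (\<Sum>k<M. real (Suc k) powr - (s - 1) - real (Suc (Suc k)) powr - (s - 1))"
    unfolding sum_distrib_left using assms powr_diff_bounds(1)[of "s - 1" "real (Suc _)"]
    by (intro sum_mono) (simp add: add.commute)
  also have "\<dots> \<le> 1"
    using sum_lessThan_telescope'[of "\<lambda>k. real (Suc k) powr - (s - 1)" M] by simp
  finally have "(\<Sum>k<M. real (Suc (Suc k)) powr - s) \<le> 1 / (s - 1)"
    using assms by (simp add: field_simps)
  moreover have "(\<Sum>k<M. real (Suc k) powr - s) \<le> 1 + (\<Sum>k<M. real (Suc (Suc k)) powr - s)"
  proof -
    have "(\<Sum>k<M. real (Suc k) powr - s) \<le> (\<Sum>k<Suc M. real (Suc k) powr - s)" by simp
    then show ?thesis unfolding sum.lessThan_Suc_shift by simp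
  qed
  moreover have "s / (s - 1) = 1 + 1 / (s - 1)" using assms by (simp add: field_simps)
  ultimately show ?thesis by linarith
qed

lemma norm_dirichlet_series_le_if_norm_sums_le:
  assumes "s > 1" "\<And>x. norm (a x) \<le> 1"
    and "\<And>M. norm (\<Sum>k<M. real (Suc k) powr - s *\<^sub>R a (int (Suc k))) \<le> C"
  shows "norm (dirichlet_series a s) \<le> C"
proof (rule LIMSEQ_le_const2)
  show "(\<lambda>M. norm (\<Sum>k<M. real (Suc k) powr - s *\<^sub>R a (int (Suc k)))) \<longlonglongrightarrow> norm (dirichlet_series a s)"
    using dirichlet_series_sums[OF assms(1,2)] unfolding sums_def by (rule tendsto_norm)
qed (use assms(3) in blast)

lemma norm_dirichlet_series_le:
  assumes "s > 1" "\<And>x. norm (a x) \<le> 1"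
  shows "norm (dirichlet_series a s) \<le> s / (s - 1)"
proof (rule norm_dirichlet_series_le_if_norm_sums_le[OF assms])
  fix M
  have "norm (\<Sum>k<M. real (Suc k) powr - s *\<^sub>R a (int (Suc k))) \<le> (\<Sum>k<M. real (Suc k) powr - s)"
    using assms(2) by (intro order_trans[OF norm_sum] sum_mono) (simp add: mult_left_le)
  also have "\<dots> \<le> s / (s - 1)" by (rule sum_powr_le[OF assms(1)])
  finally show "norm (\<Sum>k<M. real (Suc k) powr - s *\<^sub>R a (int (Suc k))) \<le> s / (s - 1)" .
qed

lemma decseq_one_over_Suc: "decseq (\<lambda>k. 1 / real (Suc k))"
  by (intro decseq_SucI) (simp add: frac_le)

definition L_at_1 :: "(int \<Rightarrow> complex) \<Rightarrow> complex" where
  "L_at_1 chi = (\<Sum>k. (1 / real (Suc k)) *\<^sub>R chi (int (Suc k)))"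

context nonprincipal_character
begin

lemma norm_dirichlet_series_chi_le:
  fixes s :: real
  assumes "s > 1"
  shows "norm (dirichlet_series chi s) \<le> N"
proof (rule norm_dirichlet_series_le_if_norm_sums_le[OF assms norm_chi_le])
  have "norm (\<Sum>k<M. real (Suc k) powr - s *\<^sub>R chi (int (Suc k))) \<le> N * real (Suc 0) powr - s" for M
    using assms
    by (intro norm_sum_decseq_le[OF norm_partial_sum_Suc_le] decseq_SucI) (auto intro!: powr_mono2')
  then show "norm (\<Sum>k<M. real (Suc k) powr - s *\<^sub>R chi (int (Suc k))) \<le> N" for M by simp
qed

lemma L_at_1_sums: "(\<lambda>k. (1 / real (Suc k)) *\<^sub>R chi (int (Suc k))) sums L_at_1 chi"
proof -
  have "(\<lambda>k. 1 / real (Suc k)) \<longlonglongrightarrow> 0" using LIMSEQ_Suc[OF lim_1_over_n] by simp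
  then have "summable (\<lambda>k. (1 / real (Suc k)) *\<^sub>R chi (int (Suc k)))"
    by (intro summable_decseq_scaleR[OF norm_partial_sum_Suc_le decseq_one_over_Suc])
  then show ?thesis unfolding L_at_1_def by (rule summable_sums)
qed

lemma norm_L_at_1_partial_sum_le:
  "norm (L_at_1 chi - (\<Sum>k<n. (1 / real (Suc k)) *\<^sub>R chi (int (Suc k)))) \<le> 2 * N / Suc n"
proof (rule LIMSEQ_le_const2)
  let ?f = "\<lambda>k. (1 / real (Suc k)) *\<^sub>R chi (int (Suc k))"
  show "(\<lambda>m. norm (sum ?f {..<m} - sum ?f {..<n})) \<longlonglongrightarrow> norm (L_at_1 chi - sum ?f {..<n})"
    using L_at_1_sums unfolding sums_def by (intro tendsto_intros)
  have "norm (sum ?f {..<m} - sum ?f {..<n}) \<le> 2 * N / Suc n" if "m \<ge> n" for m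
  proof -
    have "sum ?f {..<m} - sum ?f {..<n} = sum ?f {n..<m}"
      using that sum_diff_nat_ivl[of 0 n m ?f] by (simp add: lessThan_atLeast0)
    then show ?thesis
      using norm_sum_decseq_tail_le[OF norm_partial_sum_Suc_le decseq_one_over_Suc, of n m] by simp
  qed
  then show "\<exists>K. \<forall>m\<ge>K. norm (sum ?f {..<m} - sum ?f {..<n}) \<le> 2 * N / Suc n" by blast
qed

lemma norm_dirichlet_partial_sum_le_if_L_at_1_eq_0:
  fixes s :: real
  assumes L_at_1: "L_at_1 chi = 0" and "s > 1"
  shows "norm (\<Sum>k<M. real (Suc k) powr - s *\<^sub>R chi (int (Suc k)))
    \<le> 2 * N * (s - 1) * (\<Sum>k. 1 / real (Suc k) ^ 2) + 2 * N / Suc M"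
proof -
  define b where "b k = real (Suc k) powr - (s - 1)" for k
  define T where "T n = (\<Sum>k<n. (1 / real (Suc k)) *\<^sub>R chi (int (Suc k)))" for n
  have T: "norm (T n) \<le> 2 * N / Suc n" for n
    using norm_L_at_1_partial_sum_le[of n] by (simp add: T_def L_at_1)
  have "(\<Sum>k<M. real (Suc k) powr - s *\<^sub>R chi (int (Suc k)))
      = (\<Sum>k<M. b k *\<^sub>R (1 / real (Suc k)) *\<^sub>R chi (int (Suc k)))"
    by (intro sum.cong refl) (simp add: b_def powr_diff powr_minus field_simps)
  also have "norm \<dots> \<le> (\<Sum>k<M. \<bar>b k - b (Suc k)\<bar> * norm (T (Suc k))) + \<bar>b M\<bar> * norm (T M)"
    unfolding T_def lessThan_Suc_atMost by (rule norm_sum_by_parts_le)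
  also have "\<dots> \<le> (\<Sum>k<M. 2 * N * (s - 1) * (1 / real (Suc k) ^ 2)) + 2 * N / Suc M"
  proof (intro add_mono sum_mono)
    fix k
    have "\<bar>b k - b (Suc k)\<bar> \<le> (s - 1) / Suc k"
      using powr_Suc_diff_le[of "s - 1" k] \<open>s > 1\<close> by (simp add: b_def powr_mono2')
    moreover have "norm (T (Suc k)) \<le> 2 * N / Suc k"
      using T[of "Suc k"] frac_le[of "2 * real N" "2 * real N" "Suc k" "Suc (Suc k)"] by simp
    ultimately have "\<bar>b k - b (Suc k)\<bar> * norm (T (Suc k)) \<le> (s - 1) / Suc k * (2 * N / Suc k)"
      using \<open>s > 1\<close> by (intro mult_mono) auto
    then show "\<bar>b k - b (Suc k)\<bar> * norm (T (Suc k)) \<le> 2 * N * (s - 1) * (1 / real (Suc k) ^ 2)"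
      by (simp add: power2_eq_square mult_ac)
  next
    have "\<bar>b M\<bar> \<le> 1" using \<open>s > 1\<close> powr_mono[of "- (s - 1)" 0 "real (Suc M)"] by (simp add: b_def)
    then have "\<bar>b M\<bar> * norm (T M) \<le> 1 * (2 * N / Suc M)" using T[of M] by (intro mult_mono) auto
    then show "\<bar>b M\<bar> * norm (T M) \<le> 2 * N / Suc M" by simp
  qed
  also have "(\<Sum>k<M. 2 * N * (s - 1) * (1 / real (Suc k) ^ 2))
      = 2 * N * (s - 1) * (\<Sum>k<M. 1 / real (Suc k) ^ 2)"
    by (simp only: sum_distrib_left)
  also have "\<dots> \<le> 2 * N * (s - 1) * (\<Sum>k. 1 / real (Suc k) ^ 2)"
  proof (intro mult_left_mono sum_le_suminf)
    show "summable (\<lambda>k. 1 / real (Suc k) ^ 2)"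
      using inverse_power_summable[of 2, where 'a = real]
      by (subst summable_Suc_iff) (simp add: field_simps)
  qed (use \<open>s > 1\<close> in auto)
  finally show ?thesis by simp
qed

lemma norm_dirichlet_series_le_if_L_at_1_eq_0:
  fixes s :: real
  assumes "L_at_1 chi = 0" "s > 1"
  shows "norm (dirichlet_series chi s) \<le> 2 * N * (s - 1) * (\<Sum>k. 1 / real (Suc k) ^ 2)"
    (is "_ \<le> ?B")
proof -
  have "(\<lambda>M. ?B + 2 * N / Suc M) \<longlonglongrightarrow> ?B + 0"
    by (intro tendsto_add tendsto_const LIMSEQ_Suc lim_const_over_n)
  moreover have "(\<lambda>M. norm (\<Sum>k<M. real (Suc k) powr - s *\<^sub>R chi (int (Suc k))))
      \<longlonglongrightarrow> norm (dirichlet_series chi s)"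
    using dirichlet_series_sums[OF assms(2) norm_chi_le] unfolding sums_def by (rule tendsto_norm)
  ultimately show ?thesis
    using LIMSEQ_le norm_dirichlet_partial_sum_le_if_L_at_1_eq_0[OF assms] by fastforce
qed

lemma L_at_1_nonzero_if_complex:
  assumes m: "coprime m (int N)" "chi m ^ 2 \<noteq> 1"
  shows "L_at_1 chi \<noteq> 0"
proof
  assume L_at_1: "L_at_1 chi = 0"
  interpret square: nonprincipal_character N "\<lambda>x. chi x ^ 2"
    using dirichlet_character_square m
    by (auto simp: nonprincipal_character_def nonprincipal_character_axioms_def)
  define C where "C = 2 * N * (\<Sum>k. 1 / real (Suc k) ^ 2)"
  define K where "K = 8 * C ^ 4 * N"
  have one_le: "1 \<le> K * e" if e: "0 < e" "e \<le> 1" for e :: real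
  proof -
    have "1 \<le> norm (dirichlet_series (\<lambda>_. 1) (1 + e)) ^ 3
        * norm (dirichlet_series chi (1 + e)) ^ 4
        * norm (dirichlet_series (\<lambda>x. chi x ^ 2) (1 + e))"
      using norm_341_dirichlet_series_ge_1 e by simp
    also have "\<dots> \<le> (2 / e) ^ 3 * (C * e) ^ 4 * N"
    proof (intro mult_mono power_mono)
      have "norm (dirichlet_series (\<lambda>_. 1) (1 + e)) \<le> (1 + e) / e"
        using norm_dirichlet_series_le[of "1 + e" "\<lambda>_. 1"] e by simp
      also have "\<dots> \<le> 2 / e" using e by (intro divide_right_mono) auto
      finally show "norm (dirichlet_series (\<lambda>_. 1) (1 + e)) \<le> 2 / e" .
      show "norm (dirichlet_series chi (1 + e)) \<le> C * e"
        using norm_dirichlet_series_le_if_L_at_1_eq_0[OF L_at_1, of "1 + e"] e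
        by (simp add: C_def mult_ac)
      show "norm (dirichlet_series (\<lambda>x. chi x ^ 2) (1 + e)) \<le> N"
        using square.norm_dirichlet_series_chi_le e by simp
    qed (use e in auto)
    also have "\<dots> = K * e"
      using e by (simp add: K_def field_simps power2_eq_square power3_eq_cube power4_eq_xxxx)
    finally show ?thesis .
  qed
  have "K \<ge> 0" by (simp add: K_def)
  then have "1 \<le> K * (1 / (K + 1))" by (intro one_le) auto
  then show False using \<open>K \<ge> 0\<close> by (simp add: field_simps)
qed

end

section \<open>Nonvanishing of \<open>L(1, \<chi>)\<close> for real characters\<close>

lemma sum_divisors_coprime_mult:
  fixes f :: "nat \<Rightarrow> 'a::comm_semiring_1"
  assumes "coprime a b" and mult: "\<And>m n. coprime m n \<Longrightarrow> f (m * n) = f m * f n"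
  shows "(\<Sum>d | d dvd a * b. f d) = (\<Sum>d | d dvd a. f d) * (\<Sum>d | d dvd b. f d)"
proof -
  have coprime: "coprime x y" if "x dvd a" "y dvd b" for x y
    using that \<open>coprime a b\<close> by (meson coprime_divisors)
  have gcd: "gcd (x * y) a = x" "gcd (x * y) b = y" if "x dvd a" "y dvd b" for x y
    using that coprime[of a y] coprime[of x b]
    by (simp_all add: gcd_mult_left_left_cancel gcd_mult_left_right_cancel coprime_commute)
  have inj: "inj_on (\<lambda>(x, y). x * y) ({d. d dvd a} \<times> {d. d dvd b})"
    by (rule inj_onI) (use gcd in \<open>auto, metis+\<close>)
  have image: "(\<lambda>(x, y). x * y) ` ({d. d dvd a} \<times> {d. d dvd b}) = {d. d dvd a * b}"
  proof (intro equalityI subsetI)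
    fix d assume "d \<in> {d. d dvd a * b}"
    then obtain x y where "d = x * y" "x dvd a" "y dvd b" using division_decomp[of d a b] by auto
    then show "d \<in> (\<lambda>(x, y). x * y) ` ({d. d dvd a} \<times> {d. d dvd b})"
      by (auto intro!: image_eqI[of _ _ "(x, y)"])
  qed (auto intro: mult_dvd_mono)
  have "(\<Sum>d | d dvd a * b. f d) = (\<Sum>(x, y)\<in>{d. d dvd a} \<times> {d. d dvd b}. f (x * y))"
    unfolding image[symmetric] sum.reindex[OF inj] by (simp add: case_prod_unfold)
  also have "\<dots> = (\<Sum>(x, y)\<in>{d. d dvd a} \<times> {d. d dvd b}. f x * f y)"
    by (intro sum.cong) (auto simp: mult coprime)
  also have "\<dots> = (\<Sum>d | d dvd a. f d) * (\<Sum>d | d dvd b. f d)"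
    by (simp add: sum_product sum.cartesian_product)
  finally show ?thesis .
qed

locale sign_character =
  fixes f :: "nat \<Rightarrow> real"
  assumes mult: "f (m * n) = f m * f n" and one: "f 1 = 1" and sign: "f n \<in> {-1, 0, 1}"
begin

lemma sum_divisors_prime_power:
  assumes "prime p"
  shows "of_bool (even k) \<le> (\<Sum>d | d dvd p ^ k. f d)"
proof -
  have "(\<Sum>i\<le>k. (-1::real) ^ i) = of_bool (even k)" by (induction k) auto
  moreover have "(\<Sum>i\<le>k. (0::real) ^ i) = 1" by (induction k) auto
  ultimately have "of_bool (even k) \<le> (\<Sum>i\<le>k. f p ^ i)" using sign[of p] by auto
  also have "(\<Sum>i\<le>k. f p ^ i) = (\<Sum>i\<le>k. f (p ^ i))"
  proof (intro sum.cong refl)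
    show "f p ^ i = f (p ^ i)" for i using one by (induction i) (auto simp: mult)
  qed
  also have "(\<Sum>i\<le>k. f (p ^ i)) = (\<Sum>d\<in>(^) p ` {..k}. f d)"
    using prime_gt_1_nat[OF assms] by (simp add: sum.reindex inj_on_def)
  also have "(^) p ` {..k} = {d. d dvd p ^ k}" using divides_primepow_nat[OF assms] by auto
  finally show ?thesis .
qed

lemma sum_divisors_ge: "n > 0 \<Longrightarrow> of_bool (is_square n) \<le> (\<Sum>d | d dvd n. f d)"
proof (induction n rule: less_induct)
  case (less n)
  show ?case
  proof (cases "n = 1")
    case False
    then obtain p where p: "prime p" "p dvd n" using prime_factor_nat by blast
    obtain k m where n: "n = p ^ k * m" "\<not> p dvd m"
      using multiplicity_decompose'[of n p] less.prems p by (metis not_prime_unit neq0_conv)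
    have "k > 0" using n p by (cases k) auto
    then have "p ^ k > 1" using p by (metis one_less_power prime_gt_1_nat)
    then have m: "m < n" "m > 0" using n less.prems by auto
    have coprime: "coprime (p ^ k) m" using n p by (simp add: prime_imp_coprime)
    then have "of_bool (is_square n) = of_bool (even k) * (of_bool (is_square m) :: real)"
      using p by (simp add: n is_nth_power_mult_coprime_nat_iff is_nth_power_prime_power_nat_iff)
    also have "\<dots> \<le> (\<Sum>d | d dvd p ^ k. f d) * (\<Sum>d | d dvd m. f d)"
      using less.IH[OF m] sum_divisors_prime_power[OF p(1), of k]
      by (intro mult_mono) (auto intro: order_trans[rotated])
    also have "\<dots> = (\<Sum>d | d dvd n. f d)"
      unfolding n by (rule sum_divisors_coprime_mult[OF coprime mult, symmetric])
    finally show ?thesis .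
  qed (use one in simp)
qed

end

lemma has_sum_atLeast_1_iff:
  "(f has_sum S) {1..} \<longleftrightarrow> ((\<lambda>k. f (Suc k)) has_sum S) UNIV"
proof -
  have "{1..} = range Suc" by (auto simp: image_iff Suc_le_eq gr0_conv_Suc)
  then show ?thesis by (simp add: has_sum_reindex o_def)
qed

lemma summable_on_lambert_terms:
  fixes x :: real and a :: "nat \<Rightarrow> real"
  assumes x: "0 \<le> x" "x < 1" and a: "\<And>n. \<bar>a n\<bar> \<le> 1"
  shows "(\<lambda>(d, e). a d * x ^ (d * e)) summable_on {1..} \<times> {1..}"
proof -
  have pow: "0 \<le> x ^ d" "x ^ d \<le> x" "x ^ d < 1" if "d \<ge> 1" for d
    using that x power_decreasing[of 1 d x] by auto
  have "(\<lambda>(d, e). x ^ (d * e)) summable_on Sigma {1..} (\<lambda>_. {1..})"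
  proof (rule summable_on_SigmaI)
    show "((\<lambda>e. case (d, e) of (d, e) \<Rightarrow> x ^ (d * e)) has_sum x ^ d / (1 - x ^ d)) {1..}"
      if "d \<in> {1..}" for d
      using has_sum_geometric_from_1[of "x ^ d"] pow[of d] that x by (simp add: power_mult)
    have "(\<lambda>d. (1 / (1 - x)) * x ^ d) summable_on {1..}"
      using x
      by (intro summable_on_cmult_right has_sum_imp_summable[OF has_sum_geometric_from_1]) simp
    then show "(\<lambda>d. x ^ d / (1 - x ^ d)) summable_on {1..}"
    proof (rule summable_on_comparison_test)
      show "x ^ d / (1 - x ^ d) \<le> 1 / (1 - x) * x ^ d" "0 \<le> x ^ d / (1 - x ^ d)"
        if "d \<in> {1..}" for d
        using that x pow[of d] by (auto intro: divide_left_mono)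
    qed
  qed (use x in auto)
  then have "(\<lambda>z. norm (case z of (d, e) \<Rightarrow> a d * x ^ (d * e))) summable_on {1..} \<times> {1..}"
    by (rule Infinite_Sum.abs_summable_on_comparison_test')
      (use a x in \<open>auto simp: abs_mult intro!: mult_left_le_one_le\<close>)
  then show ?thesis by (rule abs_summable_summable)
qed

lemma lambert_series:
  fixes x :: real and a :: "nat \<Rightarrow> real"
  assumes x: "0 \<le> x" "x < 1" and a: "\<And>n. \<bar>a n\<bar> \<le> 1"
  obtains S where "((\<lambda>d. a d * (x ^ d / (1 - x ^ d))) has_sum S) {1..}"
    and "((\<lambda>n. (\<Sum>d | d dvd n. a d) * x ^ n) has_sum S) {1..}"
proof -
  define S where "S = infsum (\<lambda>(d, e). a d * x ^ (d * e)) ({1..} \<times> {1..})"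
  have S: "((\<lambda>(d, e). a d * x ^ (d * e)) has_sum S) ({1..} \<times> {1..})"
    unfolding S_def using assms by (intro has_sum_infsum summable_on_lambert_terms)
  have "((\<lambda>d. a d * (x ^ d / (1 - x ^ d))) has_sum S) {1..}"
  proof (rule has_sum_SigmaD[OF S])
    fix d :: nat assume "d \<in> {1..}"
    then have "((\<lambda>e. (x ^ d) ^ e) has_sum (x ^ d / (1 - x ^ d))) {1..}"
      using x power_decreasing[of 1 d x] by (intro has_sum_geometric_from_1) auto
    then show "((\<lambda>e. case (d, e) of (d, e) \<Rightarrow> a d * x ^ (d * e)) has_sum
        a d * (x ^ d / (1 - x ^ d))) {1..}"
      unfolding prod.case power_mult by (rule has_sum_cmult_right)
  qed
  moreover have "((\<lambda>n. (\<Sum>d | d dvd n. a d) * x ^ n) has_sum S) {1..}"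
  proof (rule has_sum_SigmaD)
    have "bij_betw (\<lambda>(n, d). (d, n div d)) (Sigma {1::nat..} (\<lambda>n. {d. d dvd n})) ({1..} \<times> {1..})"
      by (rule bij_betw_byWitness[where f' = "\<lambda>(d, e). (d * e, d)"])
        (auto simp: Suc_le_eq dvd_imp_le dvd_pos_nat div_greater_zero_iff)
    then have "((\<lambda>z. case (case z of (n, d) \<Rightarrow> (d, n div d)) of (d, e) \<Rightarrow> a d * x ^ (d * e))
        has_sum S) (Sigma {1..} (\<lambda>n. {d. d dvd n}))"
      using S by (subst has_sum_reindex_bij_betw)
    then show "((\<lambda>(n, d). a d * x ^ n) has_sum S) (Sigma {1..} (\<lambda>n. {d. d dvd n}))"
      by (rule has_sum_cong[THEN iffD1, rotated]) auto
    show "((\<lambda>d. case (n, d) of (n, d) \<Rightarrow> a d * x ^ n) has_sum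
        (\<Sum>d | d dvd n. a d) * x ^ n) {d. d dvd n}"
      if "n \<in> {1..}" for n
      using that has_sum_finite[of "{d. d dvd n}" "\<lambda>d. a d * x ^ n"]
      by (simp add: sum_distrib_right)
  qed
  ultimately show ?thesis using that by blast
qed

lemma (in sign_character) sum_power_squares_le:
  fixes x :: real
  assumes "0 < x" "((\<lambda>n. (\<Sum>d | d dvd n. f d) * x ^ n) has_sum S) {1..}"
  shows "(\<Sum>k=1..K. x ^ (k\<^sup>2)) \<le> S"
proof -
  have ge: "(of_bool (is_square n) :: real) \<le> (\<Sum>d | d dvd n. f d)" if "n \<ge> 1" for n
    using that sum_divisors_ge[of n] by simp
  have "(\<Sum>k=1..K. x ^ (k\<^sup>2)) = (\<Sum>n\<in>(\<lambda>k. k\<^sup>2) ` {1..K}. x ^ n)"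
    by (subst sum.reindex) (auto simp: inj_on_def)
  also have "\<dots> \<le> (\<Sum>n\<in>(\<lambda>k. k\<^sup>2) ` {1..K}. (\<Sum>d | d dvd n. f d) * x ^ n)"
  proof (rule sum_mono)
    fix n assume "n \<in> (\<lambda>k. k\<^sup>2) ` {1..K}"
    then have "1 \<le> (\<Sum>d | d dvd n. f d)" using ge[of n] by auto
    then show "x ^ n \<le> (\<Sum>d | d dvd n. f d) * x ^ n"
      using \<open>0 < x\<close> mult_right_mono[of 1 _ "x ^ n"] by simp
  qed
  also have "\<dots> \<le> S"
  proof (rule finite_sum_le_has_sum[OF assms(2)])
    show "0 \<le> (\<Sum>d | d dvd n. f d) * x ^ n" if "n \<in> {1..} - (\<lambda>k. k\<^sup>2) ` {1..K}" for n
      using that \<open>0 < x\<close> order_trans[OF zero_less_eq_of_bool ge] by simp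
  qed auto
  finally show ?thesis .
qed

text \<open>Pairing the \<open>i\<close>-th term with the \<open>(n - 1 - i)\<close>-th, this is the arithmetic-geometric mean
  inequality.\<close>

lemma sum_power2_power_ge:
  fixes y :: real
  assumes "y \<ge> 0"
  shows "real n * y ^ (n - 1) \<le> (\<Sum>i<n. (y\<^sup>2) ^ i)"
proof -
  have "real n * y ^ (n - 1) * 2 = (\<Sum>i<n. 2 * y ^ (n - 1))" by simp
  also have "\<dots> \<le> (\<Sum>i<n. (y\<^sup>2) ^ i + (y\<^sup>2) ^ (n - Suc i))"
  proof (rule sum_mono)
    fix i assume "i \<in> {..<n}"
    then have "2 * y ^ (n - 1) = 2 * (y ^ i * y ^ (n - Suc i))" by (simp flip: power_add)
    also have "\<dots> \<le> (y ^ i)\<^sup>2 + (y ^ (n - Suc i))\<^sup>2"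
      using sum_squares_bound[of "y ^ i" "y ^ (n - Suc i)"] by (simp add: mult.assoc)
    finally show "2 * y ^ (n - 1) \<le> (y\<^sup>2) ^ i + (y\<^sup>2) ^ (n - Suc i)"
      by (simp add: mult.commute flip: power_mult)
  qed
  also have "\<dots> = (\<Sum>i<n. (y\<^sup>2) ^ i) * 2"
    using sum.nat_diff_reindex[of "\<lambda>i. (y\<^sup>2) ^ i" n] by (simp add: sum.distrib)
  finally show ?thesis by simp
qed

lemma geometric_sums_mult_ge:
  fixes x :: real
  assumes "0 \<le> x" "x \<le> 1"
  shows "real n * real (Suc n) * x ^ n \<le> (\<Sum>i<n. x ^ i) * (\<Sum>i<Suc n. x ^ i)"
proof -
  define y where "y = sqrt x"
  have y: "x = y\<^sup>2" "0 \<le> y" "y \<le> 1" using assms by (auto simp: y_def)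
  have "x ^ n \<le> y ^ (n - 1) * y ^ n"
    unfolding y(1) power_mult[symmetric] power_add[symmetric]
    using y by (intro power_decreasing) auto
  then have "real n * real (Suc n) * x ^ n \<le> real n * real (Suc n) * (y ^ (n - 1) * y ^ n)"
    by (intro mult_left_mono) auto
  also have "\<dots> = (real n * y ^ (n - 1)) * (real (Suc n) * y ^ n)" by (simp add: mult_ac)
  also have "\<dots> \<le> (\<Sum>i<n. x ^ i) * (\<Sum>i<Suc n. x ^ i)"
    using sum_power2_power_ge[OF y(2), of n] sum_power2_power_ge[OF y(2), of "Suc n"] y
    by (intro mult_mono) (auto intro!: sum_nonneg)
  finally show ?thesis .
qed

definition monsky_weight :: "real \<Rightarrow> nat \<Rightarrow> real" where
  "monsky_weight x n = 1 / (real n * (1 - x)) - x ^ n / (1 - x ^ n)"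

lemma monsky_weight_eq:
  assumes "x < 1"
  shows "monsky_weight x n = (1 / real n - x ^ n / (\<Sum>i<n. x ^ i)) / (1 - x)"
  using assms one_diff_power_eq[of x n]
  by (simp add: monsky_weight_def diff_divide_distrib mult.commute)

lemma monsky_weight_Suc_le:
  assumes x: "0 < x" "x < 1" and "n > 0"
  shows "monsky_weight x (Suc n) \<le> monsky_weight x n"
proof -
  define G where "G n = (\<Sum>i<n. x ^ i)" for n
  have G_Suc: "G (Suc n) = 1 + x * G n"
    unfolding G_def sum.lessThan_Suc_shift by (simp add: sum_distrib_left)
  have pos: "G n > 0" "G (Suc n) > 0" unfolding G_def using x \<open>n > 0\<close> by (intro sum_pos; force)+
  have "x ^ n / G n - x ^ Suc n / G (Suc n) = x ^ n / (G n * G (Suc n))"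
    using pos by (simp add: field_simps) (simp add: G_Suc algebra_simps)
  also have "\<dots> \<le> 1 / (real n * real (Suc n))"
    using geometric_sums_mult_ge[of x n] pos x \<open>n > 0\<close> by (simp add: divide_simps G_def mult_ac)
  also have "\<dots> = 1 / real n - 1 / real (Suc n)" using \<open>n > 0\<close> by (simp add: field_simps)
  finally have "1 / real (Suc n) - x ^ Suc n / G (Suc n) \<le> 1 / real n - x ^ n / G n" by linarith
  then show ?thesis
    unfolding monsky_weight_eq[OF x(2)] G_def using x by (intro divide_right_mono) auto
qed

lemma monsky_weight_tendsto_0:
  assumes "0 < x" "x < 1"
  shows "monsky_weight x \<longlonglongrightarrow> 0"
proof -
  have "(\<lambda>n. 1 / real n * (1 / (1 - x)) - x ^ n / (1 - x ^ n)) \<longlonglongrightarrow> 0 * (1 / (1 - x)) - 0 / (1 - 0)"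
    using assms by (intro tendsto_intros lim_1_over_n LIMSEQ_realpow_zero) auto
  then show ?thesis by (simp add: monsky_weight_def[abs_def])
qed

context nonprincipal_character
begin

text \<open>Monsky's argument: if \<open>L(1, \<chi>) = 0\<close>, the Lambert series of \<open>\<chi>\<close> equals
  \<open>- (\<Sum>n. \<chi> n * monsky_weight x n)\<close> and stays bounded as \<open>x\<close> tends to 1, whereas its
  coefficients \<open>\<Sum>d | d dvd n. \<chi> d\<close> are nonnegative and at least 1 on squares.\<close>

lemma lambert_series_le_if_L_at_1_eq_0:
  assumes "L_at_1 chi = 0" and x: "0 < x" "x < 1"
    and S: "((\<lambda>d. Re (chi (int d)) * (x ^ d / (1 - x ^ d))) has_sum S) {1..}"
  shows "S \<le> N"
proof -
  define f where "f n = Re (chi (int n))" for n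
  define w where "w k = monsky_weight x (Suc k)" for k
  have "w \<longlonglongrightarrow> 0" unfolding w_def by (rule LIMSEQ_Suc[OF monsky_weight_tendsto_0[OF x]])
  have "decseq w" using x by (intro decseq_SucI) (simp add: w_def monsky_weight_Suc_le)
  have L_at_1: "(\<lambda>k. 1 / real (Suc k) * f (Suc k)) sums 0"
    using sums_Re[OF L_at_1_sums] assms(1) by (simp add: f_def)
  have "f (Suc k) * (x ^ Suc k / (1 - x ^ Suc k))
      = 1 / real (Suc k) * f (Suc k) / (1 - x) - w k * f (Suc k)" for k
    by (simp add: w_def monsky_weight_def algebra_simps)
  then have partial: "(\<Sum>k<M. f (Suc k) * (x ^ Suc k / (1 - x ^ Suc k)))
      = (\<Sum>k<M. 1 / real (Suc k) * f (Suc k)) / (1 - x) - (\<Sum>k<M. w k * f (Suc k))" for M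
    by (simp only: sum_subtractf sum_divide_distrib)
  have "- (\<Sum>k<M. w k * f (Suc k)) \<le> N" for M
  proof -
    have "norm (\<Sum>k<M. w k *\<^sub>R f (Suc k)) \<le> N * w 0"
    proof (rule norm_sum_decseq_le[OF _ \<open>decseq w\<close> decseq_ge[OF \<open>decseq w\<close> \<open>w \<longlonglongrightarrow> 0\<close>]])
      show "norm (\<Sum>k<n. f (Suc k)) \<le> N" for n
        unfolding f_def Re_sum[symmetric] real_norm_def
        using abs_Re_le_cmod norm_partial_sum_Suc_le order_trans by blast
    qed
    moreover have "w 0 = 1" using x by (simp add: w_def monsky_weight_def field_simps)
    ultimately show ?thesis by simp
  qed
  then have "(\<Sum>k<M. f (Suc k) * (x ^ Suc k / (1 - x ^ Suc k)))
      \<le> (\<Sum>k<M. 1 / real (Suc k) * f (Suc k)) / (1 - x) + N" for M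
    unfolding partial by (simp add: add_left_mono)
  moreover have "(\<lambda>M. (\<Sum>k<M. 1 / real (Suc k) * f (Suc k)) / (1 - x) + N) \<longlonglongrightarrow> 0 / (1 - x) + N"
    using L_at_1 x unfolding sums_def by (intro tendsto_intros) auto
  moreover have "(\<lambda>k. f (Suc k) * (x ^ Suc k / (1 - x ^ Suc k))) sums S"
    using S unfolding has_sum_atLeast_1_iff f_def by (rule has_sum_imp_sums)
  ultimately have "S \<le> 0 / (1 - x) + N" unfolding sums_def by (intro LIMSEQ_le) auto
  then show ?thesis by simp
qed

lemma L_at_1_nonzero_if_real:
  assumes real: "\<And>x. coprime x (int N) \<Longrightarrow> chi x ^ 2 = 1"
  shows "L_at_1 chi \<noteq> 0"
proof
  assume L_at_1: "L_at_1 chi = 0"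
  define f where "f n = Re (chi (int n))" for n
  have chi_values: "chi n \<in> {-1, 0, 1}" for n
    using real[of n] chi_eq_0[of n] by (cases "coprime n (int N)") (auto simp: power2_eq_1_iff)
  interpret sign_character f
  proof
    show "f (m * n) = f m * f n" for m n
      using chi_values[of "int m"] chi_values[of "int n"] by (auto simp: f_def chi_mult)
    show "f n \<in> {-1, 0, 1}" for n using chi_values[of "int n"] by (auto simp: f_def)
  qed (simp add: f_def chi_1)
  have bound: "(\<Sum>k=1..N+1. x ^ (k\<^sup>2)) \<le> N" if x: "0 < x" "x < 1" for x :: real
  proof -
    have "\<bar>f n\<bar> \<le> 1" for n using sign[of n] by auto
    then obtain S where S: "((\<lambda>d. f d * (x ^ d / (1 - x ^ d))) has_sum S) {1..}"
      "((\<lambda>n. (\<Sum>d | d dvd n. f d) * x ^ n) has_sum S) {1..}"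
      using lambert_series[of x f] x by auto
    show ?thesis
      using sum_power_squares_le[OF x(1) S(2), of "N + 1"]
        lambert_series_le_if_L_at_1_eq_0[OF L_at_1 x S(1)[unfolded f_def]] by linarith
  qed
  have "((\<lambda>x::real. \<Sum>k=1..N+1. x ^ (k\<^sup>2)) \<longlongrightarrow> (\<Sum>k=1..N+1. 1 ^ (k\<^sup>2))) (at_left 1)"
    by (intro tendsto_intros)
  moreover have "eventually (\<lambda>x::real. (\<Sum>k=1..N+1. x ^ (k\<^sup>2)) \<le> N) (at_left 1)"
    using eventually_at_left_real[of 0 1] by (rule eventually_mono) (use bound in simp_all)
  ultimately have "(\<Sum>k=1..N+1. 1 ^ (k\<^sup>2)) \<le> real N"
    by (intro tendsto_upperbound) auto
  then show False by simp
qed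

theorem L_at_1_nonzero: "L_at_1 chi \<noteq> 0"
  using L_at_1_nonzero_if_real L_at_1_nonzero_if_complex by blast

end

section \<open>Odd characters and sawtooth sums\<close>

lemma Digamma_reflection_real:
  fixes t :: real
  assumes "0 < t" "t < 1"
  shows "Digamma (1 - t) - Digamma t = pi * cot (pi * t)"
proof -
  have reflection: "Gamma u * Gamma (1 - u) = pi / sin (pi * u)" for u :: real
  proof -
    have "complex_of_real (Gamma u * Gamma (1 - u)) = complex_of_real (pi / sin (pi * u))"
      using Gamma_reflection_complex[of "complex_of_real u"]
      by (simp add: Gamma_complex_of_real[symmetric] sin_of_real[symmetric])
    then show ?thesis using of_real_eq_iff by blast
  qed
  have sin_pos: "sin (pi * t) > 0" using assms by (intro sin_gt_zero) auto
  have "t \<notin> \<int>\<^sub>\<le>\<^sub>0" "1 - t \<notin> \<int>\<^sub>\<le>\<^sub>0" using assms by (auto elim!: nonpos_Ints_cases)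
  then have "((\<lambda>u. Gamma u * Gamma (1 - u)) has_field_derivative
      Gamma t * Gamma (1 - t) * (Digamma t - Digamma (1 - t))) (at t)"
    by (auto intro!: derivative_eq_intros simp: algebra_simps)
  moreover have "((\<lambda>u. pi / sin (pi * u)) has_field_derivative
      pi / sin (pi * t) * (- pi * cot (pi * t))) (at t)"
    using sin_pos by (auto intro!: derivative_eq_intros simp: cot_def field_simps power2_eq_square)
  ultimately have "pi / sin (pi * t) * (Digamma t - Digamma (1 - t))
      = pi / sin (pi * t) * (- pi * cot (pi * t))"
    unfolding reflection by (rule DERIV_unique)
  then have "Digamma t - Digamma (1 - t) = - pi * cot (pi * t)"
    using sin_pos by (subst (asm) mult_left_cancel) auto
  then show ?thesis by simp
qed

lemma cot_partial_fractions:
  fixes t :: real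
  assumes "0 < t" "t < 1"
  shows "(\<lambda>M. \<Sum>q<M. 1 / (t + real q) - 1 / (1 - t + real q)) \<longlonglongrightarrow> pi * cot (pi * t)"
proof -
  have "(\<lambda>M. (of_real (ln (real M)) - (\<Sum>q<M. inverse (1 - t + of_nat q)))
       - (of_real (ln (real M)) - (\<Sum>q<M. inverse (t + of_nat q)))) \<longlonglongrightarrow> Digamma (1 - t) - Digamma t"
    using assms by (intro tendsto_diff Digamma_LIMSEQ) auto
  then show ?thesis
    unfolding Digamma_reflection_real[OF assms] by (simp add: sum_subtractf inverse_eq_divide)
qed

lemma tendsto_residue_class_cot:
  assumes "0 < x" "x < N"
  shows "(\<lambda>M. \<Sum>q<M. 1 / real (q * N + x) - 1 / real (q * N + (N - x))) \<longlonglongrightarrow> pi / N * cot (pi * x / N)"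
proof -
  define t where "t = real x / real N"
  have t: "0 < t" "t < 1" using assms by (auto simp: t_def)
  have "real (q * N + x) = (t + real q) * N" "real (q * N + (N - x)) = (1 - t + real q) * N" for q
    using assms by (simp_all add: t_def of_nat_diff field_simps)
  then have "1 / real (q * N + x) - 1 / real (q * N + (N - x))
      = (1 / (t + real q) - 1 / (1 - t + real q)) / N" for q
    by (simp only: divide_divide_eq_left diff_divide_distrib)
  then have "(\<Sum>q<M. 1 / real (q * N + x) - 1 / real (q * N + (N - x)))
      = (\<Sum>q<M. 1 / (t + real q) - 1 / (1 - t + real q)) / N" for M
    by (simp only: sum_divide_distrib)
  then show ?thesis
    using tendsto_divide[OF cot_partial_fractions[OF t] tendsto_const[of "real N"]] assms
    by (simp add: t_def)
qed

lemma sum_residue_classes: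
  fixes g :: "nat \<Rightarrow> 'a::comm_monoid_add"
  shows "(\<Sum>n<M * N. g n) = (\<Sum>x<N. \<Sum>q<M. g (q * N + x))"
proof -
  have "(\<Sum>n<M * N. g n) = (\<Sum>q<M. \<Sum>n=q * N..<q * N + N. g n)"
    by (rule sum.nat_group[symmetric])
  also have "\<dots> = (\<Sum>q<M. \<Sum>x<N. g (q * N + x))"
    by (rule sum.cong[OF refl], subst sum.atLeastLessThan_shift_0)
      (simp add: lessThan_atLeast0 add.commute)
  finally show ?thesis by (simp add: sum.swap[of _ "{..<M}"])
qed

context odd_character
begin

lemma sum_reflect_scaleR_chi:
  fixes h :: "nat \<Rightarrow> real"
  shows "(\<Sum>x<N. h (N - x) *\<^sub>R chi (int x)) = - (\<Sum>x<N. h x *\<^sub>R chi (int x))"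
proof -
  have positive: "(\<Sum>x<N. h' x *\<^sub>R chi (int x)) = (\<Sum>x=1..<N. h' x *\<^sub>R chi (int x))"
      for h' :: "nat \<Rightarrow> real"
    using N_pos by (simp add: lessThan_atLeast0 sum.atLeast_Suc_lessThan chi_zero)
  have "chi (int (N - x)) = - chi (int x)" if "x < N" for x
  proof -
    have "chi (int (N - x)) = chi (- int x)"
      using that by (intro chi_cong) (simp add: of_nat_diff less_imp_le cong_def)
    then show ?thesis by (simp add: chi_minus)
  qed
  then have "(\<Sum>x=1..<N. h x *\<^sub>R chi (int x)) = (\<Sum>x=1..<N. - (h (N - x) *\<^sub>R chi (int x)))"
    by (intro sum.reindex_bij_witness[of _ "\<lambda>x. N - x" "\<lambda>x. N - x"]) auto
  then show ?thesis unfolding positive by (simp add: sum_negf)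
qed

lemma L_at_1_eq_cot_sum:
  "L_at_1 chi = (pi / (2 * N)) *\<^sub>R (\<Sum>x<N. cot (pi * x / N) *\<^sub>R chi (int x))"
proof -
  define A where "A M x = (\<Sum>q<M. 1 / real (q * N + x))" for M x
  have "(\<lambda>n. (1 / real n) *\<^sub>R chi (int n)) sums L_at_1 chi"
    using L_at_1_sums sums_Suc_iff[of "\<lambda>n. (1 / real n) *\<^sub>R chi (int n)" "L_at_1 chi"] by simp
  then have "(\<lambda>n. \<Sum>k<n. (1 / real k) *\<^sub>R chi (int k)) \<longlonglongrightarrow> L_at_1 chi" by (simp add: sums_def)
  from LIMSEQ_subseq_LIMSEQ[OF this, of "\<lambda>M. M * N"]
  have "(\<lambda>M. \<Sum>n<M * N. (1 / real n) *\<^sub>R chi (int n)) \<longlonglongrightarrow> L_at_1 chi"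
    using N_pos by (simp add: strict_mono_def o_def)
  then have "(\<lambda>M. 2 *\<^sub>R (\<Sum>n<M * N. (1 / real n) *\<^sub>R chi (int n))) \<longlonglongrightarrow> 2 *\<^sub>R L_at_1 chi"
    by (intro tendsto_intros)
  moreover have "2 *\<^sub>R (\<Sum>n<M * N. (1 / real n) *\<^sub>R chi (int n))
      = (\<Sum>x<N. (A M x - A M (N - x)) *\<^sub>R chi (int x))" for M
  proof -
    have "chi (int (q * N + x)) = chi (int x)" for q x by (rule chi_cong) (simp add: cong_def)
    then have "(\<Sum>n<M * N. (1 / real n) *\<^sub>R chi (int n)) = (\<Sum>x<N. A M x *\<^sub>R chi (int x))"
      unfolding sum_residue_classes by (simp add: A_def scaleR_sum_left del: of_nat_add of_nat_mult)
    then show ?thesis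
      by (simp add: scaleR_diff_left sum_subtractf sum_reflect_scaleR_chi scaleR_2)
  qed
  moreover have "(\<lambda>M. \<Sum>x<N. (A M x - A M (N - x)) *\<^sub>R chi (int x))
      \<longlonglongrightarrow> (\<Sum>x<N. (pi / N * cot (pi * x / N)) *\<^sub>R chi (int x))"
  proof (intro tendsto_sum)
    show "(\<lambda>M. (A M x - A M (N - x)) *\<^sub>R chi (int x)) \<longlonglongrightarrow> (pi / N * cot (pi * x / N)) *\<^sub>R chi (int x)"
      if "x \<in> {..<N}" for x
    proof (cases "x = 0")
      case False
      then show ?thesis
        using tendsto_residue_class_cot[of x N] that unfolding A_def sum_subtractf[symmetric]
        by (intro tendsto_intros) auto
    qed (simp add: chi_zero)
  qed
  ultimately have "2 *\<^sub>R L_at_1 chi = (\<Sum>x<N. (pi / N * cot (pi * x / N)) *\<^sub>R chi (int x))"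
    by (auto intro: LIMSEQ_unique)
  also have "\<dots> = (pi / N) *\<^sub>R (\<Sum>x<N. cot (pi * x / N) *\<^sub>R chi (int x))"
    by (simp add: scaleR_sum_right)
  finally have "(1 / 2) *\<^sub>R 2 *\<^sub>R L_at_1 chi
      = (1 / 2) *\<^sub>R (pi / N) *\<^sub>R (\<Sum>x<N. cot (pi * x / N) *\<^sub>R chi (int x))"
    by simp
  then show ?thesis by simp
qed

end

lemma sum_index_root_of_unity:
  fixes z :: "'a::field"
  assumes "z ^ N = 1" "z \<noteq> 1"
  shows "(\<Sum>k<N. of_nat k * z ^ k) = of_nat N / (z - 1)"
proof -
  have "(z - 1) * (\<Sum>k<n. of_nat k * z ^ k) = of_nat n * z ^ n - z * (\<Sum>k<n. z ^ k)" for n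
    by (induction n) (auto simp: algebra_simps)
  then have "(z - 1) * (\<Sum>k<N. of_nat k * z ^ k) = of_nat N" using assms by (simp add: geometric_sum)
  then show ?thesis using assms(2) by (simp add: eq_divide_eq mult.commute)
qed

lemma inverse_cis_minus_1:
  assumes "sin (t / 2) \<noteq> 0"
  shows "1 / (cis t - 1) = - 1 / 2 - \<i> / 2 * of_real (cot (t / 2))"
proof -
  define s c where "s = sin (t / 2)" and "c = cos (t / 2)"
  have t: "cos t = 1 - 2 * s\<^sup>2" "sin t = 2 * s * c"
    using cos_double_sin[of "t / 2"] sin_double[of "t / 2"] by (simp_all add: s_def c_def)
  have cot: "s * cot (t / 2) = c" using assms by (simp add: s_def c_def cot_def)
  have "(cis t - 1) * (- 1 / 2 - \<i> / 2 * of_real (cot (t / 2))) = 1"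
  proof (rule complex_eqI)
    have "Re ((cis t - 1) * (- 1 / 2 - \<i> / 2 * of_real (cot (t / 2))))
        = s\<^sup>2 + c * (s * cot (t / 2))"
      by (simp add: t)
    then show "Re ((cis t - 1) * (- 1 / 2 - \<i> / 2 * of_real (cot (t / 2)))) = Re 1"
      unfolding cot by (simp add: s_def c_def flip: power2_eq_square)
    have "Im ((cis t - 1) * (- 1 / 2 - \<i> / 2 * of_real (cot (t / 2))))
        = s * (s * cot (t / 2)) - s * c"
      by (simp add: t power2_eq_square)
    then show "Im ((cis t - 1) * (- 1 / 2 - \<i> / 2 * of_real (cot (t / 2)))) = Im 1"
      unfolding cot by simp
  qed
  then show ?thesis by (metis divide_eq_eq mult.commute mult_zero_left zero_neq_one)
qed

lemma bij_betw_modular_inverse: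
  fixes n :: int
  assumes "n > 0"
  shows "bij_betw (modular_inverse n) {x \<in> {0..<n}. coprime x n} {x \<in> {0..<n}. coprime x n}"
proof (rule bij_betw_byWitness[where f' = "modular_inverse n"])
  have "modular_inverse n (modular_inverse n x) = x" if "x \<in> {0..<n}" "coprime x n" for x
    using that by (intro modular_inverse_int_eqI cong_modular_inverse2)
  then show "\<forall>x\<in>{x \<in> {0..<n}. coprime x n}. modular_inverse n (modular_inverse n x) = x"
    "\<forall>x\<in>{x \<in> {0..<n}. coprime x n}. modular_inverse n (modular_inverse n x) = x" by blast+
qed (use assms modular_inverse_int_nonneg modular_inverse_int_less in auto)

lemma mult_modular_inverse_mod:
  fixes k n y :: int
  assumes "coprime y n" "k \<in> {0..<n}"
  shows "(y * k mod n) * modular_inverse n y mod n = k"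
proof -
  have "(y * k mod n) * modular_inverse n y mod n = y * modular_inverse n y * k mod n"
    unfolding mod_mult_left_eq by (simp only: mult_ac)
  also have "[y * modular_inverse n y * k = 1 * k] (mod n)"
    using assms(1) by (intro cong_mult cong_modular_inverse1 cong_refl)
  then have "y * modular_inverse n y * k mod n = k" using assms(2) by (simp add: cong_def)
  finally show ?thesis .
qed

lemma cis_residue_mod:
  assumes "N > 0"
  shows "cis (2 * pi * of_int (k mod int N) / N) = cis (2 * pi * of_int k / N)"
proof -
  have "real_of_int k = real_of_int (k div int N * int N + k mod int N)" by simp
  also have "\<dots> = real_of_int (k div int N) * N + real_of_int (k mod int N)"
    by (simp only: of_int_add of_int_mult of_int_of_nat_eq)
  finally have "2 * pi * of_int k / N
      = 2 * pi * of_int (k mod int N) / N + 2 * pi * of_int (k div int N)"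
    using assms by (simp add: field_simps)
  then have "cis (2 * pi * of_int k / N)
      = cis (2 * pi * of_int (k mod int N) / N) * cis (2 * pi * of_int (k div int N))"
    by (simp only: cis_mult)
  then show ?thesis using cis_multiple_2pi[of "of_int (k div int N)"] by simp
qed

lemma cis_residue_power: "cis (2 * pi * of_int (y * int k) / N) = cis (2 * pi * of_int y / N) ^ k"
proof -
  have "2 * pi * of_int (y * int k) / N = real k * (2 * pi * of_int y / N)" by simp
  then show ?thesis by (simp only: Complex.DeMoivre)
qed

lemma sum_index_cis:
  assumes y: "0 < y" "y < int N"
  shows "(\<Sum>k<N. of_nat k * cis (2 * pi * y / N) ^ k)
    = N * (- 1 / 2 - \<i> / 2 * of_real (cot (pi * y / N)))"
proof -
  let ?t = "2 * pi * y / N"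
  have "sin (?t / 2) > 0" using y by (intro sin_gt_zero) (auto simp: field_simps)
  then have sin: "sin (?t / 2) \<noteq> 0" by simp
  have "(\<Sum>k<N. of_nat k * cis ?t ^ k) = of_nat N / (cis ?t - 1)"
  proof (rule sum_index_root_of_unity)
    show "cis ?t ^ N = 1"
      using cis_residue_mod[of N "y * int N"] cis_residue_power[of y N N] y by simp
    show "cis ?t \<noteq> 1"
    proof
      assume "cis ?t = 1"
      then have "cos (2 * (?t / 2)) = 1" by (simp add: complex_eq_iff mult.assoc)
      then show False using sin cos_double_sin[of "?t / 2"] by simp
    qed
  qed
  also have "\<dots> = N * (1 / (cis ?t - 1))" by simp
  also have "1 / (cis ?t - 1) = - 1 / 2 - \<i> / 2 * of_real (cot (pi * y / N))"
    using inverse_cis_minus_1[OF sin] by simp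
  finally show ?thesis .
qed

lemma sum_sawtooth_modular_inverse_cis:
  assumes "N > 1" and y: "y \<in> {0..<int N}" "coprime y (int N)"
  shows "(\<Sum>k\<in>{0..<int N}. of_int (k * modular_inverse (int N) y mod int N) * cis (2 * pi * k / N))
    = N * (- 1 / 2 - \<i> / 2 * of_real (cot (pi * y / N)))"
proof -
  let ?F = "\<lambda>k. of_int (k * modular_inverse (int N) y mod int N) * cis (2 * pi * of_int k / N)"
  have "N > 0" using assms(1) by simp
  have "(\<Sum>k\<in>{0..<int N}. ?F k) = (\<Sum>k\<in>{0..<int N}. ?F (y * k mod int N))"
    using sum.reindex_bij_betw[OF bij_betw_mult_residues[OF y(2)], of ?F] \<open>N > 0\<close> by simp
  also have "\<dots> = (\<Sum>k\<in>{0..<int N}. of_int k * cis (2 * pi * of_int (y * k) / N))"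
    by (intro sum.cong refl)
      (simp only: mult_modular_inverse_mod[OF y(2)] cis_residue_mod[OF \<open>N > 0\<close>])
  also have "\<dots> = (\<Sum>k<N. of_nat k * cis (2 * pi * y / N) ^ k)"
    unfolding sum_residues_nat cis_residue_power by simp
  also have "\<dots> = N * (- 1 / 2 - \<i> / 2 * of_real (cot (pi * y / N)))"
  proof (rule sum_index_cis)
    have "y \<noteq> 0" using y assms(1) by auto
    then show "0 < y" "y < int N" using y by auto
  qed
  finally show ?thesis .
qed

context dirichlet_character
begin

lemma sum_residues_eq_sum_units:
  "(\<Sum>x\<in>{0..<int N}. chi x * g x) = (\<Sum>x | x \<in> {0..<int N} \<and> coprime x (int N). chi x * g x)"
  by (rule sum.mono_neutral_right) (auto simp: chi_eq_0)

lemma chi_modular_inverse: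
  assumes "coprime x (int N)"
  shows "chi (modular_inverse (int N) x) = cnj (chi x)"
proof -
  have "chi x * chi (modular_inverse (int N) x) = 1"
    using chi_cong[OF cong_modular_inverse1[OF assms]] by (simp add: chi_mult chi_1)
  also have "1 = chi x * cnj (chi x)" using norm_chi[OF assms] by (simp flip: complex_norm_square)
  finally show ?thesis using norm_chi[OF assms] by auto
qed

end

definition sawtooth_sum :: "nat \<Rightarrow> (int \<Rightarrow> complex) \<Rightarrow> int \<Rightarrow> complex" where
  "sawtooth_sum N h k = (\<Sum>x\<in>{0..<int N}. h x * of_int (k * x mod int N))"

context odd_character
begin

lemma fourier_sawtooth_sum:
  "(\<Sum>k\<in>{0..<int N}. sawtooth_sum N chi k * cis (2 * pi * k / N))
    = - \<i> * N\<^sup>2 / pi * L_at_1 (\<lambda>x. cnj (chi x))"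
proof -
  interpret cnj: odd_character N "\<lambda>x. cnj (chi x)" by (rule odd_character_cnj)
  define U where "U = {x \<in> {0..<int N}. coprime x (int N)}"
  define F where "F x = (\<Sum>k\<in>{0..<int N}. of_int (k * x mod int N) * cis (2 * pi * k / N))" for x
  define G where "G y = N * (- 1 / 2 - \<i> / 2 * of_real (cot (pi * y / N)))" for y :: int
  have "(\<Sum>k\<in>{0..<int N}. sawtooth_sum N chi k * cis (2 * pi * k / N))
      = (\<Sum>x\<in>{0..<int N}. chi x * F x)"
    unfolding sawtooth_sum_def F_def sum_distrib_left sum_distrib_right
    by (subst sum.swap) (simp add: mult_ac)
  also have "\<dots> = (\<Sum>x\<in>U. chi x * F x)" unfolding U_def by (rule sum_residues_eq_sum_units)
  also have "\<dots> = (\<Sum>y\<in>U. chi (modular_inverse (int N) y) * F (modular_inverse (int N) y))"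
    using bij_betw_modular_inverse[of "int N"] N_pos
    by (intro sum.reindex_bij_betw[symmetric]) (simp add: U_def)
  also have "\<dots> = (\<Sum>y\<in>U. cnj (chi y) * G y)"
    using N_gt_1 by (intro sum.cong refl)
      (simp add: U_def F_def G_def chi_modular_inverse sum_sawtooth_modular_inverse_cis)
  also have "\<dots> = (\<Sum>y\<in>{0..<int N}. cnj (chi y) * G y)"
    unfolding U_def by (rule cnj.sum_residues_eq_sum_units[symmetric])
  also have "\<dots> = - N / 2 * (\<Sum>y\<in>{0..<int N}. cnj (chi y))
      - \<i> * N / 2 * (\<Sum>y\<in>{0..<int N}. cot (pi * y / N) *\<^sub>R cnj (chi y))"
    unfolding G_def sum_distrib_left sum_subtractf[symmetric]
    by (intro sum.cong refl) (simp add: scaleR_conv_of_real algebra_simps)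
  also have "\<dots> = - \<i> * N / 2 * (\<Sum>y<N. cot (pi * y / N) *\<^sub>R cnj (chi (int y)))"
    unfolding cnj.sum_residues_eq_0 by (simp add: sum_residues_nat)
  also have "\<dots> = - \<i> * N\<^sup>2 / pi * L_at_1 (\<lambda>x. cnj (chi x))"
    unfolding cnj.L_at_1_eq_cot_sum using N_pos
    by (simp add: scaleR_conv_of_real power2_eq_square)
  finally show ?thesis .
qed

lemma ex_sawtooth_sum_nonzero: "\<exists>k. sawtooth_sum N chi k \<noteq> 0"
proof -
  interpret cnj: odd_character N "\<lambda>x. cnj (chi x)" by (rule odd_character_cnj)
  have "(\<Sum>k\<in>{0..<int N}. sawtooth_sum N chi k * cis (2 * pi * k / N)) \<noteq> 0"
    unfolding fourier_sawtooth_sum using cnj.L_at_1_nonzero N_pos by simp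
  then show ?thesis by (metis (no_types, lifting) mult_zero_left sum.neutral)
qed

end

section \<open>Residues with balanced sawtooth sums\<close>

locale dilation_invariant =
  fixes N :: nat and V :: "(int \<Rightarrow> complex) set"
  assumes N_pos: "N > 0"
    and sum_closed: "\<And>(I :: nat set) c h. (\<And>i. i \<in> I \<Longrightarrow> h i \<in> V) \<Longrightarrow> (\<lambda>x. \<Sum>i\<in>I. c i * h i x) \<in> V"
    and dilate_closed: "h \<in> V \<Longrightarrow> coprime m (int N) \<Longrightarrow> (\<lambda>x. h (m * x)) \<in> V"
    and periodic: "h \<in> V \<Longrightarrow> h (x mod int N) = h x"
    and eq_0_if_not_coprime: "h \<in> V \<Longrightarrow> \<not> coprime x (int N) \<Longrightarrow> h x = 0"
begin

lemma cong_imp_eq: "h \<in> V \<Longrightarrow> [x = y] (mod int N) \<Longrightarrow> h x = h y"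
  by (metis periodic cong_def)

definition dilation_sum :: "complex \<Rightarrow> int \<Rightarrow> (int \<Rightarrow> complex) \<Rightarrow> int \<Rightarrow> complex" where
  "dilation_sum c m h x = (\<Sum>i<totient N. c ^ i * h (m ^ i * x))"

lemma dilation_sum_in:
  assumes "h \<in> V" "coprime m (int N)"
  shows "dilation_sum c m h \<in> V"
  unfolding dilation_sum_def[abs_def] using assms by (intro sum_closed dilate_closed) simp_all

lemma dilation_sum_eigenfunction:
  assumes h: "h \<in> V" and m: "coprime m (int N)" and c: "c ^ totient N = 1"
  shows "dilation_sum c m h (m * x) = 1 / c * dilation_sum c m h x"
proof -
  let ?n = "totient N"
  have "[m ^ ?n * x = 1 * x] (mod int N)" by (intro cong_mult cong_refl euler_theorem_int m N_pos)
  then have "h (m ^ ?n * x) = h x" using cong_imp_eq[OF h] by simp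
  then have "(\<Sum>i<Suc ?n. c ^ i * h (m ^ i * x)) = dilation_sum c m h x + h x"
    by (simp add: dilation_sum_def c)
  moreover have "(\<Sum>i<Suc ?n. c ^ i * h (m ^ i * x)) = h x + c * dilation_sum c m h (m * x)"
    unfolding sum.lessThan_Suc_shift by (simp add: dilation_sum_def sum_distrib_left mult_ac)
  ultimately have "c * dilation_sum c m h (m * x) = dilation_sum c m h x" by simp
  moreover have "c \<noteq> 0" using c N_pos by (auto simp: power_0_left)
  ultimately show ?thesis by (simp add: field_simps)
qed

lemma dilation_sum_preserves_eigenfunction:
  assumes "\<And>y. h (l * y) = e * h y"
  shows "dilation_sum c m h (l * x) = e * dilation_sum c m h x"
  unfolding dilation_sum_def sum_distrib_left
  by (intro sum.cong refl) (simp add: assms mult.left_commute[of _ l] mult.left_commute[of _ e])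

text \<open>Summed over all \<open>totient N\<close>-th roots of unity \<open>c\<close>, the values \<open>dilation_sum c m h x\<close> give
  \<open>totient N * h x\<close>.\<close>

lemma ex_dilation_sum_nonzero:
  assumes "h x \<noteq> 0"
  shows "\<exists>c. c ^ totient N = 1 \<and> dilation_sum c m h x \<noteq> 0"
proof -
  define n where "n = totient N"
  have "n > 0" using N_pos by (simp add: n_def)
  define w where "w j = exp (2 * of_real pi * \<i> * of_nat j / of_nat n)" for j :: nat
  have w_1: "w j = 1 \<longleftrightarrow> n dvd j" for j
    using \<open>n > 0\<close> by (simp add: w_def complex_root_unity_eq_1)
  have w_mult: "w (j * k) = w j ^ k" for j k
    by (simp add: w_def exp_of_nat_mult[symmetric] mult_ac)
  have w_swap: "w j ^ k = w k ^ j" for j k by (metis mult.commute w_mult)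
  have w_root: "w j ^ n = 1" for j using w_1[of "j * n"] by (simp add: w_mult)
  have geometric: "(\<Sum>j<n. w i ^ j) = (if i = 0 then of_nat n else 0)" if "i < n" for i
  proof (cases "i = 0")
    case False
    then have "w i \<noteq> 1" using that by (auto simp: w_1 dest: dvd_imp_le)
    then show ?thesis using False by (simp add: geometric_sum w_root)
  qed (simp add: w_def)
  have "(\<Sum>j<n. dilation_sum (w j) m h x) = (\<Sum>i<n. h (m ^ i * x) * (\<Sum>j<n. w i ^ j))"
    unfolding dilation_sum_def n_def[symmetric] sum_distrib_left
    by (subst sum.swap) (simp add: w_swap mult.commute)
  also have "\<dots> = (\<Sum>i<n. if i = 0 then of_nat n * h x else 0)"
    by (intro sum.cong refl) (simp add: geometric)
  also have "\<dots> \<noteq> 0" using \<open>n > 0\<close> assms by simp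
  finally obtain j where "dilation_sum (w j) m h x \<noteq> 0"
    using sum.neutral[of "{..<n}" "\<lambda>j. dilation_sum (w j) m h x"] by blast
  then show ?thesis using w_root unfolding n_def by blast
qed

lemma ex_common_eigenfunction:
  assumes h: "h \<in> V" "h x \<noteq> 0"
    and A: "finite A" "\<And>m. m \<in> A \<Longrightarrow> coprime m (int N)"
  shows "\<exists>g\<in>V. g x \<noteq> 0 \<and> (\<forall>m\<in>A. \<exists>e. \<forall>y. g (m * y) = e * g y)"
  using A
proof (induction A rule: finite_induct)
  case empty
  then show ?case using h by blast
next
  case (insert m A)
  then obtain g where g: "g \<in> V" "g x \<noteq> 0" "\<And>l. l \<in> A \<Longrightarrow> \<exists>e. \<forall>y. g (l * y) = e * g y"
    by (meson insertI2)
  have m: "coprime m (int N)" using insert.prems by simp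
  obtain c where c: "c ^ totient N = 1" "dilation_sum c m g x \<noteq> 0"
    using ex_dilation_sum_nonzero[of g x m] g(2) by blast
  have "\<exists>e. \<forall>y. dilation_sum c m g (l * y) = e * dilation_sum c m g y" if l: "l \<in> A" for l
  proof -
    obtain e where "\<forall>y. g (l * y) = e * g y" using g(3)[OF l] by blast
    then show ?thesis using dilation_sum_preserves_eigenfunction by blast
  qed
  moreover have "\<forall>y. dilation_sum c m g (m * y) = 1 / c * dilation_sum c m g y"
    using dilation_sum_eigenfunction[OF g(1) m c(1)] by blast
  ultimately show ?case using dilation_sum_in[OF g(1) m, of c] c(2) by blast
qed

lemma ex_dirichlet_character:
  assumes "h \<in> V" "h x \<noteq> 0"
  shows "\<exists>chi\<in>V. dirichlet_character N chi"
proof -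
  define U where "U = {0..<int N} \<inter> {m. coprime m (int N)}"
  have "\<exists>g\<in>V. g x \<noteq> 0 \<and> (\<forall>m\<in>U. \<exists>e. \<forall>y. g (m * y) = e * g y)"
    by (rule ex_common_eigenfunction[OF assms]) (simp_all add: U_def)
  then obtain g where g: "g \<in> V" "g x \<noteq> 0" "\<And>m. m \<in> U \<Longrightarrow> \<exists>e. \<forall>y. g (m * y) = e * g y"
    by blast
  have eigen: "\<exists>e. \<forall>y. g (m * y) = e * g y" if "coprime m (int N)" for m
  proof -
    have "m mod int N \<in> U" using that N_pos by (simp add: U_def)
    then obtain e where "\<And>y. g ((m mod int N) * y) = e * g y" using g(3) by blast
    moreover have "g ((m mod int N) * y) = g (m * y)" for y
      by (intro cong_imp_eq[OF g(1)]) (simp add: cong_def mod_mult_left_eq)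
    ultimately show ?thesis by auto
  qed
  have "coprime x (int N)" using eq_0_if_not_coprime[OF g(1)] g(2) by blast
  then obtain e where "\<And>y. g (x * y) = e * g y" using eigen by blast
  from this[of 1] have g_1: "g 1 \<noteq> 0" using g(2) by auto
  define chi where "chi y = 1 / g 1 * g y" for y
  have "chi \<in> V"
    using sum_closed[of "{0}" "\<lambda>_. g" "\<lambda>_. 1 / g 1"] g(1) by (simp add: chi_def[abs_def])
  moreover have "dirichlet_character N chi"
  proof
    show "chi (y * z) = chi y * chi z" for y z
    proof (cases "coprime y (int N)")
      case True
      then obtain e where e: "\<And>z. g (y * z) = e * g z" using eigen by blast
      show ?thesis using e[of z] e[of 1] g_1 by (simp add: chi_def)
    next
      case False
      then show ?thesis using eq_0_if_not_coprime[OF g(1)] by (simp add: chi_def)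
    qed
    show "chi y = 0" if "\<not> coprime y (int N)" for y
      using eq_0_if_not_coprime[OF \<open>chi \<in> V\<close> that] .
  qed (use g_1 N_pos periodic[OF g(1)] in \<open>simp_all add: chi_def\<close>)
  ultimately show ?thesis by blast
qed

end

definition sawtooth_null :: "nat \<Rightarrow> (int \<Rightarrow> complex) set" where
  "sawtooth_null N = {h. (\<forall>x. h (x mod int N) = h x) \<and> (\<forall>x. \<not> coprime x (int N) \<longrightarrow> h x = 0) \<and>
     (\<forall>x. h (- x) = - h x) \<and> (\<forall>k. sawtooth_sum N h k = 0)}"

lemma sawtooth_null_sum:
  assumes "\<And>i. i \<in> I \<Longrightarrow> h i \<in> sawtooth_null N"
  shows "(\<lambda>x. \<Sum>i\<in>I. c i * h i x) \<in> sawtooth_null N"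
proof -
  have "(\<Sum>i\<in>I. c i * h i (x mod int N)) = (\<Sum>i\<in>I. c i * h i x)" for x
    using assms by (intro sum.cong refl) (auto simp: sawtooth_null_def)
  moreover have "(\<Sum>i\<in>I. c i * h i x) = 0" if "\<not> coprime x (int N)" for x
    using assms that by (intro sum.neutral) (auto simp: sawtooth_null_def)
  moreover have "(\<Sum>i\<in>I. c i * h i (- x)) = - (\<Sum>i\<in>I. c i * h i x)" for x
    unfolding sum_negf[symmetric]
    using assms by (intro sum.cong refl) (auto simp: sawtooth_null_def)
  moreover have "sawtooth_sum N (\<lambda>x. \<Sum>i\<in>I. c i * h i x) k = 0" for k
  proof -
    have "sawtooth_sum N (\<lambda>x. \<Sum>i\<in>I. c i * h i x) k = (\<Sum>i\<in>I. c i * sawtooth_sum N (h i) k)"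
      unfolding sawtooth_sum_def sum_distrib_left sum_distrib_right
      by (subst sum.swap) (simp add: mult_ac)
    also have "\<dots> = 0" using assms by (intro sum.neutral) (auto simp: sawtooth_null_def)
    finally show ?thesis .
  qed
  ultimately show ?thesis by (simp add: sawtooth_null_def)
qed

lemma sawtooth_null_dilate:
  assumes N: "N > 0" and m: "coprime m (int N)" and h: "h \<in> sawtooth_null N"
  shows "(\<lambda>x. h (m * x)) \<in> sawtooth_null N"
proof -
  have periodic: "h (x mod int N) = h x" and odd: "h (- x) = - h x"
    and null: "sawtooth_sum N h k = 0" for x k
    using h by (auto simp: sawtooth_null_def)
  have "h (m * (x mod int N)) = h (m * x)" for x by (metis periodic mod_mult_right_eq)
  moreover have "h (m * x) = 0" if "\<not> coprime x (int N)" for x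
    using h that by (auto simp: sawtooth_null_def)
  moreover have "h (m * - x) = - h (m * x)" for x using odd[of "m * x"] by simp
  moreover have "sawtooth_sum N (\<lambda>x. h (m * x)) k = 0" for k
  proof -
    let ?i = "modular_inverse (int N) m"
    have "k * x mod int N = k * ?i * (m * x mod int N) mod int N" for x
    proof -
      have "[k * x * (?i * m) = k * x * 1] (mod int N)"
        using m by (intro cong_mult cong_refl cong_modular_inverse2)
      then have "k * x mod int N = k * x * (?i * m) mod int N" by (simp add: cong_def)
      also have "\<dots> = k * ?i * (m * x) mod int N" by (simp only: mult_ac)
      also have "\<dots> = k * ?i * (m * x mod int N) mod int N" by (simp only: mod_mult_right_eq)
      finally show ?thesis .
    qed
    then have "sawtooth_sum N (\<lambda>x. h (m * x)) k
        = (\<Sum>x\<in>{0..<int N}. h (m * x mod int N) * of_int (k * ?i * (m * x mod int N) mod int N))"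
      by (simp add: sawtooth_sum_def periodic)
    also have "\<dots> = sawtooth_sum N h (k * ?i)"
      unfolding sawtooth_sum_def
      using N by (intro sum.reindex_bij_betw bij_betw_mult_residues m) simp
    finally show ?thesis by (simp add: null)
  qed
  ultimately show ?thesis by (simp add: sawtooth_null_def)
qed

lemma sawtooth_null_eq_0:
  assumes "N > 0" and h: "h \<in> sawtooth_null N"
  shows "h x = 0"
proof (rule ccontr)
  assume "h x \<noteq> 0"
  interpret dilation_invariant N "sawtooth_null N"
  proof
    show "h (y mod int N) = h y" "\<not> coprime y (int N) \<Longrightarrow> h y = 0" if "h \<in> sawtooth_null N" for h y
      using that by (auto simp: sawtooth_null_def)
  qed (use assms(1) in \<open>simp_all add: sawtooth_null_sum sawtooth_null_dilate\<close>)
  obtain chi where chi: "chi \<in> sawtooth_null N" "dirichlet_character N chi"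
    using ex_dirichlet_character[OF h \<open>h x \<noteq> 0\<close>] by blast
  interpret dirichlet_character N chi by (rule chi(2))
  interpret odd_character N chi
    by unfold_locales (use chi(1) chi_1 in \<open>simp add: sawtooth_null_def\<close>)
  show False using ex_sawtooth_sum_nonzero chi(1) by (simp add: sawtooth_null_def)
qed

definition balanced_mod :: "nat \<Rightarrow> ('w \<Rightarrow> int) \<Rightarrow> 'w set \<Rightarrow> bool" where
  "balanced_mod N a W \<longleftrightarrow>
     (\<forall>x. card {w \<in> W. [a w = x] (mod int N)} = card {w \<in> W. [a w = - x] (mod int N)})"

theorem balanced_mod_if_sawtooth_sums_eq:
  fixes a :: "'w \<Rightarrow> int"
  assumes N: "N > 0" and "finite W" and coprime: "\<And>w. w \<in> W \<Longrightarrow> coprime (a w) (int N)"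
    and sums: "\<And>k. (\<Sum>w\<in>W. k * a w mod int N) = (\<Sum>w\<in>W. - k * a w mod int N)"
  shows "balanced_mod N a W"
  unfolding balanced_mod_def
proof
  fix y
  define g :: "int \<Rightarrow> complex" where
    "g x = (\<Sum>w\<in>W. of_bool ([a w = x] (mod int N)) - of_bool ([- a w = x] (mod int N)))" for x
  have minus_iff: "[- c = x] (mod int N) \<longleftrightarrow> [c = - x] (mod int N)" for c x
    using cong_minus_minus_iff[of c "- x" "int N"] by simp
  have "g (x mod int N) = g x" for x by (simp add: g_def cong_def)
  moreover have "g x = 0" if "\<not> coprime x (int N)" for x
  proof -
    have "\<not> [c = x] (mod int N)" if "coprime c (int N)" for c
      using \<open>\<not> coprime x (int N)\<close> that cong_imp_coprime by blast
    then show ?thesis using coprime unfolding g_def by (intro sum.neutral) simp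
  qed
  moreover have "g (- x) = - g x" for x
    unfolding g_def sum_negf[symmetric] by (simp add: minus_iff)
  moreover have "sawtooth_sum N g k = 0" for k
  proof -
    have pick: "(\<Sum>x\<in>{0..<int N}. of_bool ([c = x] (mod int N)) * of_int (k * x mod int N))
        = (of_int (k * c mod int N) :: complex)" for c
    proof -
      have "(\<Sum>x\<in>{0..<int N}. of_bool ([c = x] (mod int N)) * (of_int (k * x mod int N) :: complex))
          = (\<Sum>x\<in>{0..<int N}. if x = c mod int N then of_int (k * x mod int N) else 0)"
        by (intro sum.cong refl) (auto simp: cong_def)
      then show ?thesis using N by (simp add: mod_mult_right_eq)
    qed
    have "sawtooth_sum N g k
        = (\<Sum>w\<in>W. of_int (k * a w mod int N) - of_int (k * - a w mod int N))"
      unfolding sawtooth_sum_def g_def sum_distrib_right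
      by (subst sum.swap) (simp add: left_diff_distrib sum_subtractf pick)
    then show ?thesis using sums[of k] by (simp add: sum_subtractf flip: of_int_sum)
  qed
  ultimately have "g \<in> sawtooth_null N" by (simp add: sawtooth_null_def)
  from sawtooth_null_eq_0[OF N this, of y]
  show "card {w \<in> W. [a w = y] (mod int N)} = card {w \<in> W. [a w = - y] (mod int N)}"
    using \<open>finite W\<close> by (simp add: g_def sum_subtractf minus_iff Int_def)
qed

section \<open>Lattice points of dilated lattice simplices\<close>

lemma integer_lattice_0: "0 \<in> integer_lattice"
  by (simp add: integer_lattice_def)

lemma integer_lattice_diff: "x \<in> integer_lattice \<Longrightarrow> y \<in> integer_lattice \<Longrightarrow> x - y \<in> integer_lattice"
  by (auto simp: integer_lattice_def inner_diff_left)

lemma integer_lattice_scaleR: "k \<in> \<int> \<Longrightarrow> x \<in> integer_lattice \<Longrightarrow> k *\<^sub>R x \<in> integer_lattice"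
  by (auto simp: integer_lattice_def)

lemma integer_lattice_sum: "(\<And>i. i \<in> I \<Longrightarrow> f i \<in> integer_lattice) \<Longrightarrow> (\<Sum>i\<in>I. f i) \<in> integer_lattice"
  by (auto simp: integer_lattice_def inner_sum_left intro!: Ints_sum)

lemma norm_ge_1_if_integer_lattice:
  assumes "x \<in> integer_lattice" "x \<noteq> 0"
  shows "norm x \<ge> 1"
proof -
  obtain b where b: "b \<in> Basis" "x \<bullet> b \<noteq> 0" using assms(2) euclidean_all_zero_iff by blast
  then have "\<bar>x \<bullet> b\<bar> \<ge> 1" using assms(1) Ints_nonzero_abs_ge1 by (auto simp: integer_lattice_def)
  then show ?thesis using Basis_le_norm[OF b(1), of x] by linarith
qed

lemma finite_integer_lattice_if_bounded:
  assumes "S \<subseteq> integer_lattice" "bounded S"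
  shows "finite S"
proof (rule ccontr)
  assume "infinite S"
  then obtain x where "x islimpt S" using bounded_infinite_imp_islimpt[of S S] assms(2) by blast
  moreover have "y = x" if "x \<in> S" "y \<in> S" "dist y x < 1" for x y
    using norm_ge_1_if_integer_lattice[of "y - x"] integer_lattice_diff that assms(1)
    by (force simp: dist_norm)
  then have "\<not> x islimpt S" by (intro discrete_imp_not_islimpt[of 1]) auto
  ultimately show False by blast
qed

lemma affine_independent_unique_coords:
  fixes W :: "'a::euclidean_space set"
  assumes W: "\<not> affine_dependent W" and "sum \<kappa> W = sum \<kappa>' W"
    and "(\<Sum>v\<in>W. \<kappa> v *\<^sub>R v) = (\<Sum>v\<in>W. \<kappa>' v *\<^sub>R v)" and "v \<in> W"
  shows "\<kappa> v = \<kappa>' v"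
proof (rule ccontr)
  assume "\<kappa> v \<noteq> \<kappa>' v"
  then have "\<exists>v\<in>W. \<kappa> v - \<kappa>' v \<noteq> 0" using \<open>v \<in> W\<close> by auto
  moreover have "(\<Sum>v\<in>W. \<kappa> v - \<kappa>' v) = 0" using assms(2) by (simp add: sum_subtractf)
  moreover have "(\<Sum>v\<in>W. (\<kappa> v - \<kappa>' v) *\<^sub>R v) = 0"
    using assms(3) by (simp add: sum_subtractf scaleR_diff_left)
  ultimately have "affine_dependent W"
    unfolding affine_dependent_explicit_finite[OF aff_independent_finite[OF W]]
    by (intro exI[of _ "\<lambda>v. \<kappa> v - \<kappa>' v"] conjI)
  then show False using W by simp
qed

lemma convex_hull_affine_independent_eq_imp_eq:
  fixes V W :: "'a::euclidean_space set"
  assumes "\<not> affine_dependent V" "\<not> affine_dependent W" "convex hull V = convex hull W"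
  shows "V = W"
  using assms extreme_point_of_convex_hull_affine_independent by (metis subsetI subset_antisym)

locale full_lattice_simplex =
  fixes W :: "'a::euclidean_space set"
  assumes W_lattice: "W \<subseteq> integer_lattice" and affine_independent: "\<not> affine_dependent W"
    and card_W: "card W = DIM('a) + 1"
begin

lemma finite_W: "finite W"
  using affine_independent by (rule aff_independent_finite)

text \<open>Homogeneous barycentric coordinates: those with \<open>sum \<kappa> W = k\<close> describe the lattice points in
  the \<open>k\<close>-th dilate of the affine hull.\<close>

definition lattice_coords :: "('a \<Rightarrow> real) set" where
  "lattice_coords = {\<kappa>. sum \<kappa> W \<in> \<int> \<and> (\<Sum>v\<in>W. \<kappa> v *\<^sub>R v) \<in> integer_lattice}"

lemma lattice_coords_diff:
  "\<kappa> \<in> lattice_coords \<Longrightarrow> \<kappa>' \<in> lattice_coords \<Longrightarrow> (\<lambda>v. \<kappa> v - \<kappa>' v) \<in> lattice_coords"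
  by (auto simp: lattice_coords_def sum_subtractf scaleR_diff_left intro: integer_lattice_diff)

lemma lattice_coords_mult:
  assumes "k \<in> \<int>" "\<kappa> \<in> lattice_coords"
  shows "(\<lambda>v. k * \<kappa> v) \<in> lattice_coords"
proof -
  have "(\<Sum>v\<in>W. (k * \<kappa> v) *\<^sub>R v) = k *\<^sub>R (\<Sum>v\<in>W. \<kappa> v *\<^sub>R v)" by (simp add: scaleR_sum_right)
  then show ?thesis using assms
    by (auto simp: lattice_coords_def integer_lattice_scaleR simp flip: sum_distrib_left)
qed

lemma lattice_coords_if_Ints: "(\<And>v. v \<in> W \<Longrightarrow> \<kappa> v \<in> \<int>) \<Longrightarrow> \<kappa> \<in> lattice_coords"
  using W_lattice
  by (auto simp: lattice_coords_def intro!: integer_lattice_sum integer_lattice_scaleR)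

lemma lattice_coords_frac: "\<kappa> \<in> lattice_coords \<Longrightarrow> (\<lambda>v. frac (\<kappa> v)) \<in> lattice_coords"
  unfolding frac_def by (rule lattice_coords_diff[OF _ lattice_coords_if_Ints]) simp_all

lemma finite_lattice_coords_unit_interval:
  assumes "v \<in> W"
  shows "finite {\<kappa> v | \<kappa>. \<kappa> \<in> lattice_coords \<and> (\<forall>u\<in>W. 0 \<le> \<kappa> u \<and> \<kappa> u \<le> 1)}"
proof -
  define K where "K = {\<kappa> \<in> lattice_coords. \<forall>u\<in>W. 0 \<le> \<kappa> u \<and> \<kappa> u \<le> 1}"
  define \<Phi> where "\<Phi> \<kappa> = (sum \<kappa> W, \<Sum>u\<in>W. \<kappa> u *\<^sub>R u)" for \<kappa>
  have "\<Phi> ` K \<subseteq> integer_lattice"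
    unfolding integer_lattice_prod_eq
    by (auto simp: K_def \<Phi>_def lattice_coords_def integer_lattice_def)
  moreover have "bounded (\<Phi> ` K)"
  proof (rule boundedI)
    fix z assume "z \<in> \<Phi> ` K"
    then obtain \<kappa> where \<kappa>: "\<kappa> \<in> K" "z = \<Phi> \<kappa>" by blast
    have "\<Phi> \<kappa> = (\<Sum>u\<in>W. \<kappa> u *\<^sub>R (1, u))" by (simp add: \<Phi>_def prod_eq_iff fst_sum snd_sum)
    also have "norm \<dots> \<le> (\<Sum>u\<in>W. \<bar>\<kappa> u\<bar> * norm (1 :: real, u))"
      unfolding norm_scaleR[symmetric] by (rule norm_sum)
    also have "\<dots> \<le> (\<Sum>u\<in>W. norm (1 :: real, u))"
      using \<kappa>(1) by (intro sum_mono mult_left_le_one_le) (auto simp: K_def)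
    finally show "norm z \<le> (\<Sum>u\<in>W. norm (1 :: real, u))" using \<kappa>(2) by simp
  qed
  ultimately have "finite (\<Phi> ` K)" by (rule finite_integer_lattice_if_bounded)
  moreover have "(\<lambda>\<kappa>. \<kappa> v) ` K \<subseteq> (\<lambda>z. inv_into K \<Phi> z v) ` \<Phi> ` K"
  proof
    fix t assume "t \<in> (\<lambda>\<kappa>. \<kappa> v) ` K"
    then obtain \<kappa> where \<kappa>: "\<kappa> \<in> K" "t = \<kappa> v" by blast
    define \<kappa>' where "\<kappa>' = inv_into K \<Phi> (\<Phi> \<kappa>)"
    have "\<Phi> \<kappa>' = \<Phi> \<kappa>" using \<kappa>(1) by (simp add: \<kappa>'_def f_inv_into_f)
    then have "sum \<kappa>' W = sum \<kappa> W" "(\<Sum>u\<in>W. \<kappa>' u *\<^sub>R u) = (\<Sum>u\<in>W. \<kappa> u *\<^sub>R u)"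
      by (simp_all add: \<Phi>_def)
    from affine_independent_unique_coords[OF affine_independent this assms]
    have "\<kappa>' v = \<kappa> v" .
    then show "t \<in> (\<lambda>z. inv_into K \<Phi> z v) ` \<Phi> ` K"
      using \<kappa> by (intro image_eqI[of _ _ "\<Phi> \<kappa>"]) (auto simp: \<kappa>'_def)
  qed
  ultimately have "finite ((\<lambda>\<kappa>. \<kappa> v) ` K)" by (rule finite_surj)
  moreover have "{\<kappa> v | \<kappa>. \<kappa> \<in> lattice_coords \<and> (\<forall>u\<in>W. 0 \<le> \<kappa> u \<and> \<kappa> u \<le> 1)} = (\<lambda>\<kappa>. \<kappa> v) ` K"
    by (auto simp: K_def)
  ultimately show ?thesis by simp
qed

lemma ex_least_lattice_coord:
  assumes "w \<in> W"
  shows "\<exists>\<kappa>\<in>lattice_coords. \<kappa> w > 0 \<and> (\<forall>\<kappa>'\<in>lattice_coords. \<exists>j :: int. \<kappa>' w = j * \<kappa> w)"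
proof -
  define T where "T = {\<kappa> w | \<kappa>. \<kappa> \<in> lattice_coords \<and> (\<forall>u\<in>W. 0 \<le> \<kappa> u \<and> \<kappa> u \<le> 1)} \<inter> {0<..}"
  have "finite T" using finite_lattice_coords_unit_interval[OF assms] by (simp add: T_def)
  have "(\<lambda>v. of_bool (v = w)) \<in> lattice_coords" by (rule lattice_coords_if_Ints) simp
  then have "1 \<in> T"
    unfolding T_def by (intro IntI CollectI exI[of _ "\<lambda>v. of_bool (v = w)"]) auto
  have "Min T \<in> T" using \<open>finite T\<close> \<open>1 \<in> T\<close> by (intro Min_in) auto
  then obtain \<kappa> where \<kappa>: "\<kappa> \<in> lattice_coords" "\<kappa> w = Min T" "\<kappa> w > 0" by (auto simp: T_def)
  have "\<kappa> w \<le> 1" unfolding \<kappa>(2) using \<open>finite T\<close> \<open>1 \<in> T\<close> by (rule Min_le)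
  have "\<kappa>' w = \<lfloor>\<kappa>' w / \<kappa> w\<rfloor> * \<kappa> w" if "\<kappa>' \<in> lattice_coords" for \<kappa>'
  proof -
    define \<rho> where "\<rho> v = \<kappa>' v - \<lfloor>\<kappa>' w / \<kappa> w\<rfloor> * \<kappa> v" for v
    have "\<rho> \<in> lattice_coords" unfolding \<rho>_def[abs_def]
      by (intro lattice_coords_diff lattice_coords_mult that \<kappa>) simp
    have "\<rho> w = frac (\<kappa>' w / \<kappa> w) * \<kappa> w" using \<kappa>(3) by (simp add: \<rho>_def frac_def field_simps)
    then have \<rho>_w: "0 \<le> \<rho> w" "\<rho> w < \<kappa> w" using \<kappa>(3) frac_lt_1[of "\<kappa>' w / \<kappa> w"] by simp_all
    then have "frac (\<rho> w) = \<rho> w" using \<open>\<kappa> w \<le> 1\<close> by (simp add: frac_eq)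
    then have "\<rho> w \<in> {\<kappa> w | \<kappa>. \<kappa> \<in> lattice_coords \<and> (\<forall>u\<in>W. 0 \<le> \<kappa> u \<and> \<kappa> u \<le> 1)}"
      using lattice_coords_frac[OF \<open>\<rho> \<in> lattice_coords\<close>] frac_lt_1 less_imp_le
      by (intro CollectI exI[of _ "\<lambda>v. frac (\<rho> v)"]) auto
    then have "\<not> \<rho> w > 0" using Min_le[OF \<open>finite T\<close>, of "\<rho> w"] \<rho>_w(2) \<kappa>(2) by (auto simp: T_def)
    then show ?thesis using \<rho>_w(1) by (simp add: \<rho>_def)
  qed
  then show ?thesis using \<kappa> by blast
qed

text \<open>After subtracting multiples of \<open>w\<close> and of a vertex \<open>w0\<close> of the opposite facet, the lattice
  point with coordinates \<open>\<kappa>\<close> lies in the span of part of a lattice basis.\<close>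

lemma lattice_coords_Ints_if_basic_facet:
  assumes w: "w \<in> W" and basic: "basic_simplex (convex hull (W - {w}))"
    and \<kappa>: "\<kappa> \<in> lattice_coords" "\<kappa> w \<in> \<int>" and v: "v \<in> W"
  shows "\<kappa> v \<in> \<int>"
proof -
  obtain V w0 B where V: "\<not> affine_dependent V" "w0 \<in> V" "convex hull (W - {w}) = convex hull V"
    and B: "lattice_basis B" "(\<lambda>u. u - w0) ` (V - {w0}) \<subseteq> B"
    using basic unfolding basic_simplex_def by auto
  have "\<not> affine_dependent (W - {w})" using affine_independent affine_dependent_subset by blast
  then have "V = W - {w}" using V convex_hull_affine_independent_eq_imp_eq by metis
  then have w0: "w0 \<in> W" "w0 \<noteq> w" using V(2) by auto
  define U where "U = W - {w} - {w0}"
  have "finite U" using finite_W by (simp add: U_def)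
  have split: "sum F W = F w + F w0 + sum F U" for F :: "'a \<Rightarrow> 'b::comm_monoid_add"
    using finite_W w w0
    by (simp add: U_def sum.remove[of W w] sum.remove[of "W - {w}" w0] add.assoc)
  have UB: "(\<lambda>u. u - w0) ` U \<subseteq> B" using B(2) by (simp add: U_def \<open>V = W - {w}\<close>)
  define x where "x = (\<Sum>u\<in>U. \<kappa> u *\<^sub>R (u - w0))"
  have "x = (\<Sum>v\<in>W. \<kappa> v *\<^sub>R v) - \<kappa> w *\<^sub>R w - (sum \<kappa> W - \<kappa> w) *\<^sub>R w0"
    unfolding x_def split by (simp add: algebra_simps sum_subtractf scaleR_sum_left)
  also have "\<dots> \<in> integer_lattice"
    using \<kappa> w w0 W_lattice unfolding lattice_coords_def
    by (intro integer_lattice_diff integer_lattice_scaleR) auto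
  finally obtain c :: "'a \<Rightarrow> int" where "x = (\<Sum>b\<in>B. of_int (c b) *\<^sub>R b)"
    using B(1) unfolding lattice_basis_def by blast
  moreover define e where "e b = (if b \<in> (\<lambda>u. u - w0) ` U then \<kappa> (b + w0) else 0)" for b
  have "finite B" using B(1) by (auto simp: lattice_basis_def independent_imp_finite)
  have "x = (\<Sum>b\<in>(\<lambda>u. u - w0) ` U. e b *\<^sub>R b)"
    unfolding x_def by (subst sum.reindex) (auto simp: inj_on_def e_def intro!: sum.cong)
  also have "\<dots> = (\<Sum>b\<in>B. e b *\<^sub>R b)"
    using \<open>finite B\<close> UB by (intro sum.mono_neutral_left) (auto simp: e_def)
  ultimately have "(\<Sum>b\<in>B. (e b - of_int (c b)) *\<^sub>R b) = 0"
    by (simp add: scaleR_diff_left sum_subtractf)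
  then have "e b - of_int (c b) = 0" if "b \<in> B" for b
    using independentD[of B B "\<lambda>b. e b - of_int (c b)"] B(1) \<open>finite B\<close> that
    by (auto simp: lattice_basis_def)
  then have "e (u - w0) \<in> \<int>" if "u \<in> U" for u
    using UB that by (metis Ints_of_int eq_iff_diff_eq_0 image_subset_iff)
  then have U: "\<kappa> u \<in> \<int>" if "u \<in> U" for u using that by (force simp: e_def)
  have "\<kappa> w0 = sum \<kappa> W - \<kappa> w - sum \<kappa> U" unfolding split[of \<kappa>] by simp
  then have "\<kappa> w0 \<in> \<int>" using U \<kappa> by (auto simp: lattice_coords_def)
  then show ?thesis using U \<kappa>(2) v by (cases "v = w \<or> v = w0") (auto simp: U_def)
qed

lemma ex_cyclic_lattice_coords:
  assumes w: "w \<in> W"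
    and rigid: "\<And>\<kappa> v. \<kappa> \<in> lattice_coords \<Longrightarrow> \<kappa> w \<in> \<int> \<Longrightarrow> v \<in> W \<Longrightarrow> \<kappa> v \<in> \<int>"
  obtains N :: nat and a :: "'a \<Rightarrow> int" where "N > 0" "a w = 1"
    "\<And>\<kappa>. \<kappa> \<in> lattice_coords \<longleftrightarrow> (\<exists>j :: int. \<forall>v\<in>W. \<kappa> v - of_int j * of_int (a v) / N \<in> \<int>)"
proof -
  obtain \<kappa> where \<kappa>: "\<kappa> \<in> lattice_coords" "\<kappa> w > 0"
    "\<And>\<kappa>'. \<kappa>' \<in> lattice_coords \<Longrightarrow> \<exists>j :: int. \<kappa>' w = j * \<kappa> w"
    using ex_least_lattice_coord[OF w] by blast
  have "(\<lambda>v. of_bool (v = w)) \<in> lattice_coords" by (rule lattice_coords_if_Ints) simp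
  from \<kappa>(3)[OF this] obtain n :: int where n: "1 = n * \<kappa> w" by auto
  then have "n > 0" using \<kappa>(2) by (metis of_int_0_less_iff zero_less_mult_pos2 zero_less_one)
  define N where "N = nat n"
  have N: "N > 0" "N * \<kappa> w = 1" using \<open>n > 0\<close> n by (simp_all add: N_def)
  have "(\<lambda>v. N * \<kappa> v) \<in> lattice_coords" using \<kappa>(1) by (intro lattice_coords_mult) auto
  then have Ints: "N * \<kappa> v \<in> \<int>" if "v \<in> W" for v using rigid[of "\<lambda>v. N * \<kappa> v"] that N(2) by simp
  define a where "a v = \<lfloor>N * \<kappa> v\<rfloor>" for v
  have a: "of_int j * of_int (a v) / N = of_int j * \<kappa> v" if "v \<in> W" for v and j :: int
    using Ints[OF that] N(1) by (auto simp: a_def elim: Ints_cases)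
  have "\<kappa>' \<in> lattice_coords \<longleftrightarrow> (\<exists>j :: int. \<forall>v\<in>W. \<kappa>' v - of_int j * of_int (a v) / N \<in> \<int>)" for \<kappa>'
  proof
    assume \<kappa>': "\<kappa>' \<in> lattice_coords"
    then obtain j :: int where j: "\<kappa>' w = j * \<kappa> w" using \<kappa>(3) by blast
    have "(\<lambda>v. \<kappa>' v - of_int j * \<kappa> v) \<in> lattice_coords"
      by (intro lattice_coords_diff lattice_coords_mult \<kappa>(1) \<kappa>') simp
    from rigid[OF this] have "\<kappa>' v - of_int j * \<kappa> v \<in> \<int>" if "v \<in> W" for v
      using that by (simp add: j)
    then show "\<exists>j :: int. \<forall>v\<in>W. \<kappa>' v - of_int j * of_int (a v) / N \<in> \<int>" using a by metis
  next
    assume "\<exists>j :: int. \<forall>v\<in>W. \<kappa>' v - of_int j * of_int (a v) / N \<in> \<int>"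
    then obtain j :: int where "\<And>v. v \<in> W \<Longrightarrow> \<kappa>' v - of_int j * \<kappa> v \<in> \<int>" using a by metis
    then have "(\<lambda>v. \<kappa>' v - of_int j * \<kappa> v) \<in> lattice_coords" by (rule lattice_coords_if_Ints)
    from lattice_coords_diff[OF this lattice_coords_mult[of "of_int (- j)", OF _ \<kappa>(1)]]
    show "\<kappa>' \<in> lattice_coords" by simp
  qed
  moreover have "a w = 1" using N(2) by (simp add: a_def)
  ultimately show ?thesis using that[OF N(1)] by blast
qed

end

locale cyclic_lattice_simplex = full_lattice_simplex W
  for W :: "'a::euclidean_space set" +
  fixes N :: nat and a :: "'a \<Rightarrow> int"
  assumes N_pos: "N > 0" and coprime_a: "v \<in> W \<Longrightarrow> coprime (a v) (int N)"
    and lattice_coords_iff: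
      "\<kappa> \<in> lattice_coords \<longleftrightarrow> (\<exists>j :: int. \<forall>v\<in>W. \<kappa> v - of_int j * of_int (a v) / N \<in> \<int>)"

lemma (in full_lattice_simplex) ex_cyclic_lattice_simplex:
  assumes basic: "\<And>v. v \<in> W \<Longrightarrow> basic_simplex (convex hull (W - {v}))" and w: "w \<in> W"
  shows "\<exists>N a. cyclic_lattice_simplex W N a \<and> a w = 1"
proof -
  note rigid = lattice_coords_Ints_if_basic_facet[OF _ basic]
  obtain N :: nat and a :: "'a \<Rightarrow> int" where N: "N > 0" and "a w = 1" and coords:
    "\<And>\<kappa>. \<kappa> \<in> lattice_coords \<longleftrightarrow> (\<exists>j :: int. \<forall>v\<in>W. \<kappa> v - of_int j * of_int (a v) / N \<in> \<int>)"
    by (rule ex_cyclic_lattice_coords[OF w]) (erule (2) rigid[OF w w], rule that)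
  have "coprime (a v) (int N)" if v: "v \<in> W" for v
  proof -
    define g where "g = gcd (a v) (int N)"
    have "g > 0" "g dvd int N" "g dvd a v" using N by (simp_all add: g_def)
    then obtain q r where q: "int N = g * q" and r: "a v = g * r" by (meson dvdE)
    have "real N = of_int g * of_int q" by (metis q of_int_mult of_int_of_nat_eq)
    then have q_over_N: "of_int q * of_int (a v) / N = real_of_int r"
      "of_int q * of_int (a w) / N = 1 / real_of_int g"
      using N \<open>g > 0\<close> by (auto simp: r \<open>a w = 1\<close>)
    have "(\<lambda>v. of_int q * of_int (a v) / N) \<in> lattice_coords"
      unfolding coords by (rule exI[of _ q]) simp
    then have "of_int q * of_int (a w) / N \<in> \<int>" by (rule rigid[OF v v _ _ w]) (simp add: q_over_N)
    then obtain z :: int where "1 / real_of_int g = of_int z"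
      unfolding q_over_N by (auto elim: Ints_cases)
    then have "real_of_int (g * z) = 1" using \<open>g > 0\<close> by (simp add: field_simps)
    then have "g * z = 1" by linarith
    then have "g dvd 1" by (metis dvd_triv_left)
    then show ?thesis by (simp add: g_def coprime_iff_gcd_eq_1)
  qed
  then have "cyclic_lattice_simplex W N a" using N coords by unfold_locales
  then show ?thesis using \<open>a w = 1\<close> by blast
qed

section \<open>Pairing the vertices\<close>

lemma card_Collect_insert:
  assumes "finite V" "w \<notin> V"
  shows "card {u \<in> insert w V. P u} = of_bool (P w) + card {u \<in> V. P u}"
proof -
  have "{u \<in> insert w V. P u} = (if P w then insert w {u \<in> V. P u} else {u \<in> V. P u})" by auto
  then show ?thesis using assms by simp
qed

lemma balanced_mod_remove_pair:
  assumes "balanced_mod N a (insert w (insert w' V))" "finite V" "w \<noteq> w'" "w \<notin> V" "w' \<notin> V"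
    and opposite: "int N dvd a w + a w'"
  shows "balanced_mod N a V"
  unfolding balanced_mod_def
proof
  fix x
  have "[a w = x] (mod int N) \<longleftrightarrow> [a w' = - x] (mod int N)" for x
  proof -
    have "[a w' = - a w] (mod int N)" using opposite by (simp add: cong_iff_dvd_diff add.commute)
    then have "[a w' = - x] (mod int N) \<longleftrightarrow> [- a w = - x] (mod int N)" by (meson cong_sym cong_trans)
    then show ?thesis by (simp add: cong_minus_minus_iff)
  qed
  note opposite_iff = this[of x] this[of "- x"]
  have "finite (insert w' V)" "w \<notin> insert w' V" using assms by auto
  note count = card_Collect_insert[OF this] card_Collect_insert[OF \<open>finite V\<close> \<open>w' \<notin> V\<close>]
  have "card {u \<in> insert w (insert w' V). [a u = x] (mod int N)}
      = card {u \<in> insert w (insert w' V). [a u = - x] (mod int N)}"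
    using assms(1) by (simp only: balanced_mod_def)
  then show "card {u \<in> V. [a u = x] (mod int N)} = card {u \<in> V. [a u = - x] (mod int N)}"
    unfolding count using opposite_iff by simp
qed

lemma ex_opposite_residue:
  assumes "balanced_mod N a W" "finite W" "w \<in> W" "W \<noteq> {w}"
    and coprime: "\<And>w. w \<in> W \<Longrightarrow> coprime (a w) (int N)"
  shows "\<exists>w'\<in>W - {w}. int N dvd a w + a w'"
proof (cases "int N dvd 2 * a w")
  case True
  then have "int N dvd 2"
    using coprime[OF \<open>w \<in> W\<close>] by (simp add: coprime_commute coprime_dvd_mult_left_iff)
  then have "N dvd 2" by (metis int_dvd_int_iff of_nat_numeral)
  then have N: "N = 1 \<or> N = 2" using dvd_imp_le[of N 2] by (auto simp: le_Suc_eq numeral_2_eq_2)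
  obtain w' where w': "w' \<in> W - {w}" using assms(3,4) by blast
  have "N = 2 \<Longrightarrow> odd (a w) \<and> odd (a w')" using coprime[OF \<open>w \<in> W\<close>] coprime[of w'] w' by simp
  then have "int N dvd a w + a w'" using N by auto
  then show ?thesis using w' by blast
next
  case False
  have "w \<in> {v \<in> W. [a v = a w] (mod int N)}" using assms(3) by simp
  then have "card {v \<in> W. [a v = a w] (mod int N)} \<noteq> 0"
    using assms(2) by (subst card_eq_0_iff) auto
  then have "card {v \<in> W. [a v = - a w] (mod int N)} \<noteq> 0"
    using assms(1) by (simp add: balanced_mod_def)
  then have "{v \<in> W. [a v = - a w] (mod int N)} \<noteq> {}" by (metis card.empty)
  then obtain w' where w': "w' \<in> W" "[a w' = - a w] (mod int N)" by blast
  then have "int N dvd a w + a w'" by (simp add: cong_iff_dvd_diff add.commute)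
  moreover from this have "w' \<noteq> w" using False by auto
  ultimately show ?thesis using w' by blast
qed

lemma ex_pairing_if_balanced_mod:
  assumes "finite I" "finite W" "card W = 2 * card I" "balanced_mod N a W"
    and "\<And>w. w \<in> W \<Longrightarrow> coprime (a w) (int N)"
  shows "\<exists>f g. W = f ` I \<union> g ` I \<and> (\<forall>i\<in>I. int N dvd a (f i) + a (g i))"
  using assms
proof (induction I arbitrary: W rule: finite_induct)
  case empty
  then show ?case by simp
next
  case (insert i I)
  have "card W \<ge> 2" using insert by simp
  then obtain w where w: "w \<in> W" by fastforce
  then have "W \<noteq> {w}" using \<open>card W \<ge> 2\<close> by auto
  then obtain w' where w': "w' \<in> W" "w' \<noteq> w" "int N dvd a w + a w'"
    using ex_opposite_residue[OF insert.prems(3,1) w _ insert.prems(4)] by blast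
  define V where "V = W - {w, w'}"
  have W: "W = insert w (insert w' V)" using w w' by (auto simp: V_def)
  have V: "finite V" "w \<notin> V" "w' \<notin> V" using insert.prems(1) by (auto simp: V_def)
  have "\<exists>f g. V = f ` I \<union> g ` I \<and> (\<forall>i\<in>I. int N dvd a (f i) + a (g i))"
  proof (rule insert.IH)
    show "card V = 2 * card I" using insert V w' by (simp add: W)
    show "balanced_mod N a V"
      using balanced_mod_remove_pair[of N a w w' V] insert.prems(3) V w' unfolding W by simp
    show "coprime (a v) (int N)" if "v \<in> V" for v using that insert.prems(4) by (simp add: W)
  qed (rule V(1))
  then obtain f g where fg: "V = f ` I \<union> g ` I" "\<forall>i\<in>I. int N dvd a (f i) + a (g i)" by blast
  have "(f(i := w)) ` insert i I = insert w (f ` I)" "(g(i := w')) ` insert i I = insert w' (g ` I)"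
    using insert.hyps(2) by auto
  then have "W = (f(i := w)) ` insert i I \<union> (g(i := w')) ` insert i I"
    unfolding W fg(1) by auto
  moreover have "\<forall>j\<in>insert i I. int N dvd a ((f(i := w)) j) + a ((g(i := w')) j)"
    using fg(2) w'(3) by auto
  ultimately show ?case by blast
qed

definition hollow :: "'a::euclidean_space set \<Rightarrow> bool" where
  "hollow S \<longleftrightarrow> interior S \<inter> integer_lattice = {}"

lemma (in full_lattice_simplex) positive_combination_in_interior_dilate:
  assumes "k > 0" and \<kappa>: "\<And>v. v \<in> W \<Longrightarrow> \<kappa> v > 0" "sum \<kappa> W = k"
  shows "(\<Sum>v\<in>W. \<kappa> v *\<^sub>R v) \<in> interior ((\<lambda>x. k *\<^sub>R x) ` (convex hull W))"
proof -
  have "(\<Sum>v\<in>W. \<kappa> v / k) = 1" using \<kappa>(2) \<open>k > 0\<close> by (simp flip: sum_divide_distrib)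
  then have "\<exists>u. (\<forall>v\<in>W. 0 < u v) \<and> sum u W = 1 \<and> (\<Sum>v\<in>W. u v *\<^sub>R v) = (\<Sum>v\<in>W. (\<kappa> v / k) *\<^sub>R v)"
    using \<kappa>(1) \<open>k > 0\<close> by (intro exI[of _ "\<lambda>v. \<kappa> v / k"]) simp
  then have "(\<Sum>v\<in>W. (\<kappa> v / k) *\<^sub>R v) \<in> interior (convex hull W)"
    unfolding interior_convex_hull_explicit_minimal[OF affine_independent] card_W by simp
  moreover have "(\<Sum>v\<in>W. \<kappa> v *\<^sub>R v) = k *\<^sub>R (\<Sum>v\<in>W. (\<kappa> v / k) *\<^sub>R v)"
    using \<open>k > 0\<close> by (simp add: scaleR_sum_right)
  moreover have "interior ((\<lambda>x. k *\<^sub>R x) ` (convex hull W))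
      = (\<lambda>x. k *\<^sub>R x) ` interior (convex hull W)"
    using \<open>k > 0\<close> by (intro interior_injective_linear_image) (auto simp: inj_on_def)
  ultimately show ?thesis by blast
qed

context cyclic_lattice_simplex
begin

lemma residue_pos:
  assumes "v \<in> W" "\<not> int N dvd j"
  shows "j * a v mod int N > 0"
proof -
  have "\<not> int N dvd j * a v"
    using assms coprime_a[OF assms(1)] by (simp add: coprime_commute coprime_dvd_mult_left_iff)
  then have "j * a v mod int N \<noteq> 0" by (simp add: dvd_eq_mod_eq_0)
  moreover have "j * a v mod int N \<ge> 0" using N_pos by simp
  ultimately show ?thesis by linarith
qed

lemma residue_coords: "(\<lambda>v. of_int (j * a v mod int N) / N) \<in> lattice_coords"
proof -
  have "of_int (j * a v mod int N) / N - of_int j * of_int (a v) / N = - of_int (j * a v div int N)"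
      for v
  proof -
    have "real_of_int (j * a v) = real_of_int (j * a v div int N * int N + j * a v mod int N)"
      by simp
    also have "\<dots> = real_of_int (j * a v div int N) * N + real_of_int (j * a v mod int N)"
      by (simp only: of_int_add of_int_mult of_int_of_nat_eq)
    finally show ?thesis using N_pos by (simp add: field_simps)
  qed
  then have "of_int (j * a v mod int N) / N - of_int j * of_int (a v) / N \<in> \<int>" for v by simp
  then show ?thesis unfolding lattice_coords_iff by blast
qed

lemma residue_sum_ge_if_hollow_dilates:
  assumes hollow: "\<And>k. k \<in> {1..d - 1} \<Longrightarrow> hollow ((\<lambda>x. real k *\<^sub>R x) ` (convex hull W))"
    and j: "\<not> int N dvd j"
  shows "int d * int N \<le> (\<Sum>v\<in>W. j * a v mod int N)"
proof -
  define \<kappa> where "\<kappa> v = of_int (j * a v mod int N) / real N" for v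
  have \<kappa>: "\<kappa> \<in> lattice_coords" unfolding \<kappa>_def[abs_def] by (rule residue_coords)
  have \<kappa>_pos: "\<kappa> v > 0" if "v \<in> W" for v using residue_pos[OF that j] N_pos by (simp add: \<kappa>_def)
  have "W \<noteq> {}" using card_W by auto
  then have "sum \<kappa> W > 0" using finite_W \<kappa>_pos by (intro sum_pos)
  moreover have "sum \<kappa> W \<in> \<int>" using \<kappa> by (simp add: lattice_coords_def)
  then obtain z :: int where "sum \<kappa> W = of_int z" by (auto elim: Ints_cases)
  ultimately have k: "sum \<kappa> W = real (nat z)" "nat z > 0" by simp_all
  have "(\<Sum>v\<in>W. \<kappa> v *\<^sub>R v) \<in> interior ((\<lambda>x. real (nat z) *\<^sub>R x) ` (convex hull W))"
    using k \<kappa>_pos by (intro positive_combination_in_interior_dilate) auto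
  moreover have "(\<Sum>v\<in>W. \<kappa> v *\<^sub>R v) \<in> integer_lattice" using \<kappa> by (simp add: lattice_coords_def)
  ultimately have "nat z \<notin> {1..d - 1}" using hollow unfolding hollow_def by blast
  then have "d \<le> nat z" using k(2) by auto
  then have "real d * N \<le> sum \<kappa> W * N" unfolding k(1) by (intro mult_right_mono) auto
  also have "\<dots> = of_int (\<Sum>v\<in>W. j * a v mod int N)"
    using N_pos by (simp add: \<kappa>_def flip: sum_divide_distrib)
  finally have "real_of_int (int d * int N) \<le> of_int (\<Sum>v\<in>W. j * a v mod int N)" by simp
  then show ?thesis by (simp only: of_int_le_iff)
qed

lemma residue_sums_eq_if_hollow_dilates:
  assumes card: "card W = 2 * d"
    and hollow: "\<And>k. k \<in> {1..d - 1} \<Longrightarrow> hollow ((\<lambda>x. real k *\<^sub>R x) ` (convex hull W))"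
  shows "(\<Sum>v\<in>W. j * a v mod int N) = (\<Sum>v\<in>W. - j * a v mod int N)"
proof (cases "int N dvd j")
  case True
  then have "j * a v mod int N = 0" "- j * a v mod int N = 0" for v by simp_all
  then show ?thesis by simp
next
  case False
  have "- j * a v mod int N = int N - j * a v mod int N" if "v \<in> W" for v
    using residue_pos[OF that False] by (simp add: zmod_zminus1_eq_if)
  then have "(\<Sum>v\<in>W. - j * a v mod int N) = (\<Sum>v\<in>W. int N - j * a v mod int N)"
    by (intro sum.cong refl)
  also have "\<dots> = 2 * (int d * int N) - (\<Sum>v\<in>W. j * a v mod int N)" by (simp add: sum_subtractf card)
  finally show ?thesis
    using residue_sum_ge_if_hollow_dilates[where d = d and j = j, OF hollow]
      residue_sum_ge_if_hollow_dilates[where d = d and j = "- j", OF hollow] False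
    by (simp add: mult.commute)
qed

lemma ex_pairing_if_hollow_dilates:
  assumes "CARD('d::finite) = d" "card W = 2 * d"
    and hollow: "\<And>k. k \<in> {1..d - 1} \<Longrightarrow> hollow ((\<lambda>x. real k *\<^sub>R x) ` (convex hull W))"
  shows "\<exists>f g :: 'd \<Rightarrow> 'a. W = range f \<union> range g \<and> (\<forall>i. int N dvd a (f i) + a (g i))"
proof -
  have "balanced_mod N a W"
    using N_pos finite_W coprime_a residue_sums_eq_if_hollow_dilates[OF assms(2) hollow]
    by (rule balanced_mod_if_sawtooth_sums_eq)
  then show ?thesis
    using ex_pairing_if_balanced_mod[of "UNIV :: 'd set" W N a] finite_W coprime_a assms(1,2)
    by simp
qed

end

section \<open>Affine maps and barycentric coordinates\<close>

lemma affine_map_sum: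
  assumes "affine_map f" "sum \<kappa> W = 1"
  shows "f (\<Sum>v\<in>W. \<kappa> v *\<^sub>R v) = (\<Sum>v\<in>W. \<kappa> v *\<^sub>R f v)"
proof -
  obtain L c where L: "linear L" "\<And>x. f x = L x + c"
    using assms(1) unfolding affine_map_def by blast
  have "(\<Sum>v\<in>W. \<kappa> v *\<^sub>R f v) = (\<Sum>v\<in>W. \<kappa> v *\<^sub>R L v) + sum \<kappa> W *\<^sub>R c"
    by (simp add: L(2) scaleR_add_right sum.distrib scaleR_sum_left)
  then show ?thesis using assms(2) L by (simp add: linear_sum linear_scale)
qed

lemma affine_map_combination:
  assumes "affine_map f" "s + t = 1"
  shows "f (s *\<^sub>R x + t *\<^sub>R y) = s *\<^sub>R f x + t *\<^sub>R f y"
proof -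
  obtain L c where L: "linear L" "\<And>x. f x = L x + c"
    using assms(1) unfolding affine_map_def by blast
  have "s *\<^sub>R f x + t *\<^sub>R f y = s *\<^sub>R L x + t *\<^sub>R L y + (s + t) *\<^sub>R c"
    by (simp add: L(2) algebra_simps)
  then show ?thesis using assms(2) L by (simp add: linear_add linear_scale)
qed

lemma affine_map_convex_hull:
  assumes "affine_map f"
  shows "f ` (convex hull S) = convex hull (f ` S)"
proof -
  obtain L c where L: "linear L" "\<And>x. f x = L x + c" using assms unfolding affine_map_def by blast
  have "f ` X = (+) c ` L ` X" for X unfolding image_image by (simp add: L(2) add.commute)
  then show ?thesis using L(1) by (simp add: convex_hull_translation convex_hull_linear_image)
qed

lemma affine_map_extend:
  fixes W :: "'a::euclidean_space set" and f :: "'a \<Rightarrow> 'b::euclidean_space"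
  assumes W: "\<not> affine_dependent W" and "W \<noteq> {}"
  obtains \<phi> where "affine_map \<phi>" "\<And>w. w \<in> W \<Longrightarrow> \<phi> w = f w"
proof -
  obtain w0 where w0: "w0 \<in> W" using \<open>W \<noteq> {}\<close> by blast
  have "independent ((\<lambda>x. - w0 + x) ` (W - {w0}))"
    using W affine_dependent_iff_dependent2[OF w0] by blast
  from linear_independent_extend[OF this, of "\<lambda>x. f (x + w0) - f w0"]
  obtain L where L: "linear L" "\<And>x. x \<in> (\<lambda>x. - w0 + x) ` (W - {w0}) \<Longrightarrow> L x = f (x + w0) - f w0"
    by blast
  have "L (w - w0) + f w0 = f w" if "w \<in> W" for w
    using L(2)[of "- w0 + w"] that linear_0[OF L(1)] by (cases "w = w0") auto
  moreover have "affine_map (\<lambda>x. L (x - w0) + f w0)"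
    unfolding affine_map_def using L(1)
    by (intro exI[of _ L] exI[of _ "f w0 - L w0"]) (simp add: linear_diff)
  ultimately show ?thesis using that by blast
qed

context full_lattice_simplex
begin

definition barycentric :: "'a \<Rightarrow> 'a \<Rightarrow> real" where
  "barycentric x = (SOME \<kappa>. sum \<kappa> W = 1 \<and> (\<Sum>v\<in>W. \<kappa> v *\<^sub>R v) = x)"

lemma sum_barycentric: "sum (barycentric x) W = 1"
  and barycentric_combination: "(\<Sum>v\<in>W. barycentric x v *\<^sub>R v) = x"
proof -
  have "x \<in> affine hull W" using affine_independent_span_eq[OF affine_independent] card_W by simp
  then have "\<exists>\<kappa>. sum \<kappa> W = 1 \<and> (\<Sum>v\<in>W. \<kappa> v *\<^sub>R v) = x"
    unfolding affine_hull_finite[OF finite_W] by blast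
  from someI_ex[OF this] show "sum (barycentric x) W = 1" "(\<Sum>v\<in>W. barycentric x v *\<^sub>R v) = x"
    by (auto simp: barycentric_def)
qed

lemma barycentric_unique:
  assumes "sum \<kappa> W = 1" "v \<in> W"
  shows "barycentric (\<Sum>v\<in>W. \<kappa> v *\<^sub>R v) v = \<kappa> v"
  by (rule affine_independent_unique_coords[OF affine_independent _ _ assms(2)])
    (simp_all add: sum_barycentric barycentric_combination assms(1))

lemma barycentric_in_lattice_coords_iff: "barycentric x \<in> lattice_coords \<longleftrightarrow> x \<in> integer_lattice"
  by (simp add: lattice_coords_def sum_barycentric barycentric_combination)

lemma affine_map_barycentric:
  fixes f :: "'a \<Rightarrow> 'b::euclidean_space"
  shows "affine_map (\<lambda>x. \<Sum>v\<in>W. barycentric x v *\<^sub>R f v)"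
proof -
  have "W \<noteq> {}" using card_W by auto
  then obtain \<phi> where \<phi>: "affine_map \<phi>" "\<And>w. w \<in> W \<Longrightarrow> \<phi> w = f w"
    using affine_map_extend[OF affine_independent, of f] by blast
  have "(\<Sum>v\<in>W. barycentric x v *\<^sub>R f v) = \<phi> x" for x
    using affine_map_sum[OF \<phi>(1) sum_barycentric, of x] by (simp add: barycentric_combination \<phi>(2))
  then show ?thesis using \<phi>(1) by simp
qed

lemma barycentric_vertex:
  fixes f :: "'a \<Rightarrow> 'b::real_vector"
  assumes "w \<in> W"
  shows "(\<Sum>v\<in>W. barycentric w v *\<^sub>R f v) = f w"
proof -
  have indicator: "(\<Sum>v\<in>W. of_bool (v = w) *\<^sub>R g v) = g w" for g :: "'a \<Rightarrow> 'c::real_vector"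
    using finite_W assms by (simp add: of_bool_def if_distrib[of "\<lambda>t. t *\<^sub>R _"] cong: if_cong)
  have "barycentric w v = of_bool (v = w)" if "v \<in> W" for v
    using barycentric_unique[of "\<lambda>v. of_bool (v = w)" v] indicator[of "\<lambda>v. v"]
      indicator[of "\<lambda>_. 1 :: real"] that by simp
  then show ?thesis using indicator[of f] by simp
qed

end

section \<open>Cayley polytopes\<close>

lemma cayley_polytope_fst_nonneg:
  fixes \<Sigma> :: "'r::finite \<Rightarrow> 'a::euclidean_space set"
  assumes "p \<in> cayley_polytope \<Sigma>"
  shows "fst p $ i \<ge> 0"
proof -
  have "convex {p :: (real ^ 'r) \<times> 'a. fst p $ i \<ge> 0}" by (auto simp: convex_def)
  then have "cayley_polytope \<Sigma> \<subseteq> {p. fst p $ i \<ge> 0}"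
    unfolding cayley_polytope_def by (rule hull_minimal[rotated]) (auto simp: axis_def)
  then show ?thesis using assms by auto
qed

text \<open>Moving slightly away from a point over the \<open>i\<close>-th vertex stays in \<open>S\<close>, so the \<open>i\<close>-th
  coordinate cannot vanish.\<close>

lemma cayley_polytope_fst_pos_in_interior:
  fixes S :: "'b::real_normed_vector set"
  assumes \<phi>: "affine_map \<phi>" "\<phi> ` S = cayley_polytope \<Sigma>" and "\<Sigma> i \<noteq> {}" and x: "x \<in> interior S"
  shows "fst (\<phi> x) $ i > 0"
proof -
  obtain p where "p \<in> \<Sigma> i" using \<open>\<Sigma> i \<noteq> {}\<close> by blast
  then have "(axis i 1, p) \<in> cayley_polytope \<Sigma>"
    unfolding cayley_polytope_def by (auto intro!: hull_inc)
  then obtain z where z: "\<phi> z = (axis i 1, p)" unfolding \<phi>(2)[symmetric] by (metis imageE)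
  obtain e where e: "e > 0" "ball x e \<subseteq> S" using x mem_interior by blast
  define t where "t = e / (2 * (norm (x - z) + 1))"
  have "t > 0" using e(1) by (simp add: t_def add_nonneg_pos)
  have "norm (t *\<^sub>R (x - z)) < e"
  proof -
    have "norm (t *\<^sub>R (x - z)) = e * (norm (x - z) / (2 * (norm (x - z) + 1)))"
      using \<open>t > 0\<close> e(1) by (simp add: t_def)
    also have "\<dots> < e * 1"
      using e(1) by (intro mult_strict_left_mono) (auto simp: divide_simps add_nonneg_pos)
    finally show ?thesis by simp
  qed
  then have "x + t *\<^sub>R (x - z) \<in> S" using e(2) by (auto simp: dist_norm)
  then have "\<phi> (x + t *\<^sub>R (x - z)) \<in> cayley_polytope \<Sigma>" using \<phi>(2) by blast
  then have "0 \<le> fst (\<phi> (x + t *\<^sub>R (x - z))) $ i" by (rule cayley_polytope_fst_nonneg)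
  also have "x + t *\<^sub>R (x - z) = (1 + t) *\<^sub>R x + (- t) *\<^sub>R z" by (simp add: algebra_simps)
  also have "\<phi> \<dots> = (1 + t) *\<^sub>R \<phi> x + (- t) *\<^sub>R \<phi> z" by (rule affine_map_combination[OF \<phi>(1)]) simp
  also have "fst \<dots> $ i = (1 + t) * fst (\<phi> x) $ i - t" by (simp add: z)
  finally have "0 < (1 + t) * fst (\<phi> x) $ i" using \<open>t > 0\<close> by simp
  then show ?thesis using \<open>t > 0\<close> by (simp add: zero_less_mult_iff)
qed

lemma hollow_dilate_if_cayley_isomorphic:
  fixes S :: "'b::euclidean_space set" and \<Sigma> :: "'r::finite \<Rightarrow> 'a::euclidean_space set"
  assumes "cayley_isomorphic S (cayley_polytope \<Sigma>)" and ne: "\<And>i. \<Sigma> i \<noteq> {}"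
    and k: "0 < k" "k < CARD('r)"
  shows "hollow ((\<lambda>x. real k *\<^sub>R x) ` S)"
proof (rule ccontr)
  assume "\<not> ?thesis"
  moreover have "interior ((\<lambda>x. real k *\<^sub>R x) ` S) = (\<lambda>x. real k *\<^sub>R x) ` interior S"
    using k by (intro interior_injective_linear_image) (auto simp: inj_on_def)
  ultimately obtain x where x: "x \<in> interior S" "real k *\<^sub>R x \<in> integer_lattice"
    unfolding hollow_def by auto
  obtain \<phi> where \<phi>: "affine_map \<phi>" "bij_betw \<phi> UNIV cayley_hyperplane"
    "\<phi> ` integer_lattice = cayley_hyperplane \<inter> integer_lattice" "\<phi> ` S = cayley_polytope \<Sigma>"
    using assms(1) unfolding cayley_isomorphic_def by blast
  have \<phi>_Ints: "fst (\<phi> y) $ i \<in> \<int>" if "y \<in> integer_lattice" for y i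
  proof -
    have "\<phi> y \<in> integer_lattice" using \<phi>(3) that by blast
    then show ?thesis
      unfolding integer_lattice_prod_eq by (auto simp: mem_Times_iff integer_lattice_vec_iff)
  qed
  have "1 \<le> real k * fst (\<phi> x) $ i" for i
  proof -
    have "\<phi> (real k *\<^sub>R x + (1 - real k) *\<^sub>R 0) = real k *\<^sub>R \<phi> x + (1 - real k) *\<^sub>R \<phi> 0"
      by (rule affine_map_combination[OF \<phi>(1)]) simp
    then have "real k * fst (\<phi> x) $ i = fst (\<phi> (real k *\<^sub>R x)) $ i - (1 - real k) * fst (\<phi> 0) $ i"
      by simp
    also have "\<dots> \<in> \<int>" using x(2) integer_lattice_0 by (intro Ints_diff Ints_mult \<phi>_Ints) auto
    finally obtain n :: int where n: "real k * fst (\<phi> x) $ i = of_int n" by (auto elim: Ints_cases)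
    moreover have "real k * fst (\<phi> x) $ i > 0"
      using cayley_polytope_fst_pos_in_interior[OF \<phi>(1,4) ne x(1)] k by simp
    ultimately show ?thesis by simp
  qed
  then have "(\<Sum>i\<in>(UNIV :: 'r set). 1) \<le> (\<Sum>i\<in>UNIV. real k * fst (\<phi> x) $ i)" by (intro sum_mono)
  moreover have "\<phi> x \<in> cayley_hyperplane" using \<phi>(2) by (auto simp: bij_betw_def)
  then have "(\<Sum>i\<in>UNIV. fst (\<phi> x) $ i) = 1" by (auto simp: cayley_hyperplane_def)
  ultimately show False using k by (simp flip: sum_distrib_left)
qed

lemma convex_hull_Union_slices:
  "convex hull (\<Union>i. {e i} \<times> (convex hull (S i))) = convex hull (\<Union>i. {e i} \<times> S i)"
proof (rule subset_antisym)
  have "{e i} \<times> (convex hull (S i)) \<subseteq> convex hull (\<Union>i. {e i} \<times> S i)" for i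
  proof -
    have "{e i} \<times> (convex hull (S i)) = convex hull ({e i} \<times> S i)" by (simp add: convex_hull_Times)
    also have "\<dots> \<subseteq> convex hull (\<Union>i. {e i} \<times> S i)" by (rule hull_mono) blast
    finally show ?thesis .
  qed
  then show "convex hull (\<Union>i. {e i} \<times> (convex hull (S i))) \<subseteq> convex hull (\<Union>i. {e i} \<times> S i)"
    by (intro hull_minimal) auto
  show "convex hull (\<Union>i. {e i} \<times> S i) \<subseteq> convex hull (\<Union>i. {e i} \<times> (convex hull (S i)))"
    by (rule hull_mono) (auto intro: hull_inc)
qed

locale paired_lattice_simplex = cyclic_lattice_simplex W N a
  for W :: "'a::euclidean_space set" and N :: nat and a :: "'a \<Rightarrow> int" +
  fixes v0 v1 :: "'d::finite \<Rightarrow> 'a" and s :: 'd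
  assumes W_eq: "W = range v0 \<union> range v1" and card_W_eq: "card W = 2 * CARD('d)"
    and opposite: "int N dvd a (v0 i) + a (v1 i)" and a_v1_s: "a (v1 s) = 1"
begin

lemma inj_v0: "inj v0" and inj_v1: "inj v1" and disjoint_ranges: "range v0 \<inter> range v1 = {}"
proof -
  have "card (range v0) \<le> CARD('d)" "card (range v1) \<le> CARD('d)" by (simp_all add: card_image_le)
  moreover have "card (range v0) + card (range v1) = 2 * CARD('d) + card (range v0 \<inter> range v1)"
    unfolding card_W_eq[symmetric] W_eq by (intro card_Un_Int) auto
  ultimately have "card (range v0) = CARD('d)" "card (range v1) = CARD('d)"
    "card (range v0 \<inter> range v1) = 0"
    by linarith+
  then show "inj v0" "inj v1" "range v0 \<inter> range v1 = {}" by (simp_all add: eq_card_imp_inj_on)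
qed

lemma sum_W:
  fixes F :: "'a \<Rightarrow> 'b::comm_monoid_add"
  shows "sum F W = (\<Sum>i\<in>UNIV. F (v0 i)) + (\<Sum>i\<in>UNIV. F (v1 i))"
  unfolding W_eq using disjoint_ranges inj_v0 inj_v1 by (simp add: sum.union_disjoint sum.reindex)

lemma v0_in_W: "v0 i \<in> W" and v1_in_W: "v1 i \<in> W"
  unfolding W_eq by auto

lemma ball_W_iff: "(\<forall>v\<in>W. P v) \<longleftrightarrow> (\<forall>i. P (v0 i) \<and> P (v1 i))"
  unfolding W_eq by auto

lemma image_W: "F ` W = (\<Union>i. {F (v0 i), F (v1 i)})"
  unfolding W_eq by auto

definition pair_case :: "('d \<Rightarrow> 'b) \<Rightarrow> ('d \<Rightarrow> 'b) \<Rightarrow> 'a \<Rightarrow> 'b" where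
  "pair_case f g w = (if w \<in> range v0 then f (inv_into UNIV v0 w) else g (inv_into UNIV v1 w))"

lemma pair_case_v0: "pair_case f g (v0 i) = f i"
  using inj_v0 by (simp add: pair_case_def)

lemma pair_case_v1: "pair_case f g (v1 i) = g i"
  using inj_v1 disjoint_ranges by (auto simp: pair_case_def)

text \<open>In barycentric coordinates \<open>\<kappa>\<close>, the isomorphism is given by \<open>\<mu> i = \<kappa> (v0 i) + \<kappa> (v1 i)\<close>,
  \<open>\<psi> i = \<kappa> (v1 i) - a (v1 i) * \<kappa> (v1 s)\<close> for \<open>i \<noteq> s\<close>, and \<open>\<psi> s = N * \<kappa> (v1 s)\<close>; the numbers
  \<open>\<mu> i\<close> and \<open>\<psi> i\<close> are all integral exactly at the lattice points.\<close>

definition shear :: "'d \<Rightarrow> real" where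
  "shear i = (if i = s then real N else 0) - real_of_int (a (v1 i))"

definition segment_end :: "'d \<Rightarrow> real ^ 'd" where
  "segment_end i = axis i 1 + (if i = s then \<chi> j. shear j else 0)"

definition cayley_map :: "'a \<Rightarrow> (real ^ 'd) \<times> (real ^ 'd)" where
  "cayley_map x = (\<Sum>v\<in>W. barycentric x v *\<^sub>R
     pair_case (\<lambda>i. (axis i 1, 0)) (\<lambda>i. (axis i 1, segment_end i)) v)"

definition cayley_coords :: "(real ^ 'd) \<times> (real ^ 'd) \<Rightarrow> 'a \<Rightarrow> real" where
  "cayley_coords = (\<lambda>(\<mu>, \<psi>). pair_case
     (\<lambda>i. \<mu> $ i - (\<psi> $ i - \<psi> $ s / N * shear i)) (\<lambda>i. \<psi> $ i - \<psi> $ s / N * shear i))"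

lemma shear_s: "shear s = real N - 1"
  by (simp add: shear_def a_v1_s)

lemma affine_map_cayley_map: "affine_map cayley_map"
  unfolding cayley_map_def[abs_def] by (rule affine_map_barycentric)

lemma cayley_map_v0: "cayley_map (v0 i) = (axis i 1, 0)"
  unfolding cayley_map_def barycentric_vertex[OF v0_in_W] by (rule pair_case_v0)

lemma cayley_map_v1: "cayley_map (v1 i) = (axis i 1, segment_end i)"
  unfolding cayley_map_def barycentric_vertex[OF v1_in_W] by (rule pair_case_v1)

lemma fst_cayley_map: "fst (cayley_map x) $ i = barycentric x (v0 i) + barycentric x (v1 i)"
  unfolding cayley_map_def sum_W pair_case_v0 pair_case_v1
  by (simp add: fst_sum axis_def if_distrib[of "\<lambda>t. _ * t"] cong: if_cong)

lemma snd_cayley_map: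
  "snd (cayley_map x) $ i = barycentric x (v1 i) + barycentric x (v1 s) * shear i"
proof -
  have "snd (cayley_map x) $ i = (\<Sum>j\<in>UNIV. barycentric x (v1 j) * segment_end j $ i)"
    unfolding cayley_map_def sum_W pair_case_v0 pair_case_v1 by (simp add: snd_sum)
  also have "\<dots> = (\<Sum>j\<in>UNIV. (if j = i then barycentric x (v1 j) else 0)
      + (if j = s then barycentric x (v1 j) * shear i else 0))"
    by (intro sum.cong refl) (auto simp: segment_end_def axis_def distrib_left)
  finally show ?thesis by (simp add: sum.distrib)
qed

lemma snd_cayley_map_s: "snd (cayley_map x) $ s = N * barycentric x (v1 s)"
  by (simp add: snd_cayley_map shear_s algebra_simps)

lemma cayley_map_in_hyperplane: "cayley_map x \<in> cayley_hyperplane"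
proof -
  have "(\<Sum>i\<in>UNIV. fst (cayley_map x) $ i) = sum (barycentric x) W"
    by (simp add: fst_cayley_map sum.distrib sum_W)
  then show ?thesis by (simp add: cayley_hyperplane_def split_beta sum_barycentric)
qed

lemma cayley_coords_cayley_map:
  assumes "v \<in> W"
  shows "cayley_coords (cayley_map x) v = barycentric x v"
proof -
  have v1: "snd (cayley_map x) $ i - snd (cayley_map x) $ s / N * shear i = barycentric x (v1 i)"
      for i
    unfolding snd_cayley_map_s using N_pos by (simp add: snd_cayley_map)
  then have "cayley_coords (cayley_map x) (v0 i) = barycentric x (v0 i)"
    "cayley_coords (cayley_map x) (v1 i) = barycentric x (v1 i)" for i
    by (simp_all add: cayley_coords_def case_prod_beta pair_case_v0 pair_case_v1 fst_cayley_map)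
  then show ?thesis using assms unfolding W_eq by auto
qed

lemma sum_cayley_coords: "z \<in> cayley_hyperplane \<Longrightarrow> sum (cayley_coords z) W = 1"
  unfolding sum_W
  by (auto simp: cayley_coords_def pair_case_v0 pair_case_v1 sum_subtractf cayley_hyperplane_def)

lemma cayley_map_cayley_coords:
  assumes "z \<in> cayley_hyperplane"
  shows "cayley_map (\<Sum>v\<in>W. cayley_coords z v *\<^sub>R v) = z"
proof -
  obtain \<mu> \<psi> where z: "z = (\<mu>, \<psi>)" by (cases z)
  define x where "x = (\<Sum>v\<in>W. cayley_coords z v *\<^sub>R v)"
  have bary: "barycentric x v = cayley_coords z v" if "v \<in> W" for v
    unfolding x_def by (rule barycentric_unique[OF sum_cayley_coords[OF assms] that])
  have v1: "barycentric x (v1 i) = \<psi> $ i - \<psi> $ s / N * shear i" for i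
    by (simp add: bary v1_in_W cayley_coords_def z pair_case_v1)
  have v0: "barycentric x (v0 i) = \<mu> $ i - barycentric x (v1 i)" for i
    unfolding v1 by (simp add: bary v0_in_W cayley_coords_def z pair_case_v0)
  have "barycentric x (v1 s) = \<psi> $ s / N"
    unfolding v1 shear_s using N_pos by (simp add: field_simps)
  then have "fst (cayley_map x) = \<mu>" "snd (cayley_map x) = \<psi>"
    unfolding vec_eq_iff fst_cayley_map snd_cayley_map by (simp_all add: v0 v1)
  then show ?thesis by (simp add: x_def z prod_eq_iff)
qed

lemma bij_betw_cayley_map: "bij_betw cayley_map UNIV cayley_hyperplane"
proof (rule bij_betw_byWitness[where f' = "\<lambda>z. \<Sum>v\<in>W. cayley_coords z v *\<^sub>R v"])
  have "(\<Sum>v\<in>W. cayley_coords (cayley_map x) v *\<^sub>R v) = x" for x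
    by (simp add: cayley_coords_cayley_map barycentric_combination)
  then show "\<forall>x\<in>UNIV. (\<Sum>v\<in>W. cayley_coords (cayley_map x) v *\<^sub>R v) = x" by blast
qed (auto simp: cayley_map_in_hyperplane cayley_map_cayley_coords)

lemma opposite_quotients: "of_int (a (v0 i)) / real N + of_int (a (v1 i)) / real N \<in> \<int>"
proof -
  obtain e where "a (v0 i) + a (v1 i) = int N * e" using opposite by blast
  then have "real_of_int (a (v0 i) + a (v1 i)) = real_of_int (int N * e)" by (rule arg_cong)
  then have "of_int (a (v0 i)) / real N + of_int (a (v1 i)) / real N = of_int e"
    using N_pos by (simp add: field_simps)
  then show ?thesis by simp
qed

lemma cayley_map_in_integer_lattice:
  assumes "x \<in> integer_lattice"
  shows "cayley_map x \<in> integer_lattice"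
proof -
  define \<kappa> where "\<kappa> = barycentric x"
  have "\<kappa> \<in> lattice_coords" using assms by (simp add: \<kappa>_def barycentric_in_lattice_coords_iff)
  then obtain j :: int where
    v0: "\<And>i. \<kappa> (v0 i) - j * (a (v0 i) / N) \<in> \<int>" and v1: "\<And>i. \<kappa> (v1 i) - j * (a (v1 i) / N) \<in> \<int>"
    unfolding lattice_coords_iff ball_W_iff by auto
  have "fst (cayley_map x) $ i \<in> \<int>" for i
  proof -
    have "fst (cayley_map x) $ i = (\<kappa> (v0 i) - j * (a (v0 i) / N)) + (\<kappa> (v1 i) - j * (a (v1 i) / N))
        + j * (a (v0 i) / N + a (v1 i) / N)"
      by (simp add: fst_cayley_map \<kappa>_def algebra_simps)
    also have "\<dots> \<in> \<int>"
      by (rule Ints_add[OF Ints_add[OF v0 v1] Ints_mult[OF Ints_of_int opposite_quotients]])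
    finally show ?thesis .
  qed
  moreover have "snd (cayley_map x) $ i \<in> \<int>" for i
  proof -
    have "snd (cayley_map x) $ i = (\<kappa> (v1 i) - j * (a (v1 i) / N))
        + (\<kappa> (v1 s) - j * (a (v1 s) / N)) * shear i + (if i = s then j else 0)"
      using N_pos by (simp add: snd_cayley_map \<kappa>_def a_v1_s shear_def field_simps)
    also have "\<dots> \<in> \<int>" using v1 by (auto simp: shear_def)
    finally show ?thesis .
  qed
  ultimately show ?thesis
    unfolding integer_lattice_prod_eq by (simp add: mem_Times_iff integer_lattice_vec_iff)
qed

lemma in_integer_lattice_if_cayley_map:
  assumes "cayley_map x \<in> integer_lattice"
  shows "x \<in> integer_lattice"
proof -
  define \<kappa> where "\<kappa> = barycentric x"
  have fst: "fst (cayley_map x) $ i \<in> \<int>" and snd: "snd (cayley_map x) $ i \<in> \<int>" for i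
    using assms
    unfolding integer_lattice_prod_eq by (auto simp: mem_Times_iff integer_lattice_vec_iff)
  obtain j :: int where j: "snd (cayley_map x) $ s = j" using snd by (auto elim: Ints_cases)
  then have "\<kappa> (v1 s) = j / N" using N_pos by (simp add: snd_cayley_map_s \<kappa>_def field_simps)
  then have "\<kappa> (v1 i) - j * (a (v1 i) / N) = snd (cayley_map x) $ i - (if i = s then j else 0)"
      for i
    using N_pos by (simp add: snd_cayley_map \<kappa>_def shear_def field_simps)
  then have v1: "\<kappa> (v1 i) - j * (a (v1 i) / N) \<in> \<int>" for i using snd by auto
  have "\<kappa> (v0 i) - j * (a (v0 i) / N) \<in> \<int>" for i
  proof -
    have "\<kappa> (v0 i) - j * (a (v0 i) / N) = fst (cayley_map x) $ i - (\<kappa> (v1 i) - j * (a (v1 i) / N))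
        - j * (a (v0 i) / N + a (v1 i) / N)"
      by (simp add: fst_cayley_map \<kappa>_def algebra_simps)
    also have "\<dots> \<in> \<int>"
      by (rule Ints_diff[OF Ints_diff[OF fst v1] Ints_mult[OF Ints_of_int opposite_quotients]])
    finally show ?thesis .
  qed
  then have "\<kappa> \<in> lattice_coords" unfolding lattice_coords_iff ball_W_iff using v1 by auto
  then show ?thesis by (simp add: \<kappa>_def barycentric_in_lattice_coords_iff)
qed

lemma cayley_map_image_integer_lattice:
  "cayley_map ` integer_lattice = cayley_hyperplane \<inter> integer_lattice"
proof (intro equalityI subsetI)
  fix z :: "(real ^ 'd) \<times> (real ^ 'd)" assume z: "z \<in> cayley_hyperplane \<inter> integer_lattice"
  then obtain x where "z = cayley_map x"
    using bij_betw_cayley_map by (auto simp: bij_betw_def image_iff)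
  then show "z \<in> cayley_map ` integer_lattice" using z in_integer_lattice_if_cayley_map by blast
qed (auto simp: cayley_map_in_hyperplane cayley_map_in_integer_lattice)

lemma cayley_map_image_convex_hull:
  "cayley_map ` (convex hull W) = cayley_polytope (\<lambda>i. convex hull {0, segment_end i})"
proof -
  have "cayley_map ` W = (\<Union>i. {cayley_map (v0 i), cayley_map (v1 i)})" by (rule image_W)
  also have "\<dots> = (\<Union>i. {axis i 1} \<times> {0, segment_end i})" by (simp add: cayley_map_v0 cayley_map_v1)
  finally have "cayley_map ` W = (\<Union>i. {axis i 1} \<times> {0, segment_end i})" .
  then show ?thesis
    unfolding affine_map_convex_hull[OF affine_map_cayley_map] cayley_polytope_def
      convex_hull_Union_slices
    by simp
qed

lemma lattice_simplex_segment: "lattice_simplex 1 (convex hull {0, segment_end i})"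
proof -
  have "segment_end i $ i \<noteq> 0" using N_pos by (auto simp: segment_end_def shear_s)
  then have "0 \<noteq> segment_end i" by auto
  moreover have "segment_end i \<in> integer_lattice"
    by (auto simp: integer_lattice_vec_iff segment_end_def axis_def shear_def)
  ultimately show ?thesis unfolding lattice_simplex_def
    by (intro exI[of _ "{0, segment_end i}"]) (auto simp: integer_lattice_0 affine_independent_2)
qed

lemma ex_cayley_isomorphic:
  "\<exists>\<Sigma> :: 'd \<Rightarrow> (real ^ 'd) set. (\<forall>i. lattice_simplex 1 (\<Sigma> i)) \<and>
     cayley_isomorphic (convex hull W) (cayley_polytope \<Sigma>)"
  unfolding cayley_isomorphic_def
  by (intro exI[of _ "\<lambda>i. convex hull {0, segment_end i}"] exI[of _ cayley_map] conjI allI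
      lattice_simplex_segment affine_map_cayley_map bij_betw_cayley_map
      cayley_map_image_integer_lattice cayley_map_image_convex_hull)

end

lemma (in cyclic_lattice_simplex) ex_cayley_isomorphic_if_pairing:
  fixes f g :: "'d::finite \<Rightarrow> 'a"
  assumes W: "W = range f \<union> range g" "card W = 2 * CARD('d)"
    and opposite: "\<And>i. int N dvd a (f i) + a (g i)" and w: "w \<in> W" "a w = 1"
  shows "\<exists>\<Sigma> :: 'd \<Rightarrow> (real ^ 'd) set. (\<forall>i. lattice_simplex 1 (\<Sigma> i)) \<and>
     cayley_isomorphic (convex hull W) (cayley_polytope \<Sigma>)"
proof (cases "w \<in> range g")
  case True
  then obtain s where "a (g s) = 1" using w(2) by auto
  then interpret paired_lattice_simplex W N a f g s by unfold_locales (use W opposite in auto)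
  show ?thesis by (rule ex_cayley_isomorphic)
next
  case False
  then obtain s where "a (f s) = 1" using w W(1) by auto
  then interpret paired_lattice_simplex W N a g f s
    by unfold_locales (use W opposite in \<open>auto simp: add.commute\<close>)
  show ?thesis by (rule ex_cayley_isomorphic)
qed

lemma (in full_lattice_simplex) ex_cayley_isomorphic_if_hollow_dilates:
  assumes "CARD('d::finite) = d" "card W = 2 * d"
    and basic: "\<And>v. v \<in> W \<Longrightarrow> basic_simplex (convex hull (W - {v}))"
    and hollow: "\<And>k. k \<in> {1..d - 1} \<Longrightarrow> hollow ((\<lambda>x. real k *\<^sub>R x) ` (convex hull W))"
  shows "\<exists>\<Sigma> :: 'd \<Rightarrow> (real ^ 'd) set. (\<forall>i. lattice_simplex 1 (\<Sigma> i)) \<and>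
     cayley_isomorphic (convex hull W) (cayley_polytope \<Sigma>)"
proof -
  obtain w where w: "w \<in> W" using card_W by fastforce
  obtain N a where cyclic: "cyclic_lattice_simplex W N a" and "a w = 1"
    using ex_cyclic_lattice_simplex[OF basic w] by blast
  interpret cyclic_lattice_simplex W N a by (rule cyclic)
  obtain f g :: "'d \<Rightarrow> 'a" where "W = range f \<union> range g" "\<And>i. int N dvd a (f i) + a (g i)"
    using ex_pairing_if_hollow_dilates[OF assms(1,2) hollow] by blast
  then show ?thesis
    using ex_cayley_isomorphic_if_pairing[of f g w] w \<open>a w = 1\<close> assms(1,2) by simp
qed

lemma lattice_simplex_nonempty: "lattice_simplex k S \<Longrightarrow> S \<noteq> {}"
  unfolding lattice_simplex_def by fastforce

theorem theorem1p6:
  fixes d :: nat and \<Delta> :: "(real ^ 'm) set"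
  assumes "d \<ge> 1" and "CARD('d::finite) = d" and "CARD('m) = 2 * d - 1"
    and "lattice_simplex (2 * d - 1) \<Delta>"
    and "\<And>F. F facet_of \<Delta> \<Longrightarrow> basic_simplex F"
  shows "(\<forall>k\<in>{1..d - 1}. interior ((\<lambda>x. real k *\<^sub>R x) ` \<Delta>) \<inter> integer_lattice = {}) \<longleftrightarrow>
    (\<exists>\<Sigma> :: 'd \<Rightarrow> (real ^ 'd) set.
       (\<forall>i. lattice_simplex 1 (\<Sigma> i)) \<and> cayley_isomorphic \<Delta> (cayley_polytope \<Sigma>))"
proof -
  obtain W where W: "W \<subseteq> integer_lattice" "\<not> affine_dependent W"
    "card W = 2 * d" "\<Delta> = convex hull W"
    using assms(1,4) unfolding lattice_simplex_def by auto
  interpret full_lattice_simplex W by unfold_locales (use W assms(1,3) in auto)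
  have basic: "basic_simplex (convex hull (W - {v}))" if "v \<in> W" for v
    using that W assms(1,5) facet_of_convex_hull_affine_independent_alt[OF affine_independent]
    by auto
  show ?thesis
  proof
    assume "\<exists>\<Sigma> :: 'd \<Rightarrow> (real ^ 'd) set.
        (\<forall>i. lattice_simplex 1 (\<Sigma> i)) \<and> cayley_isomorphic \<Delta> (cayley_polytope \<Sigma>)"
    then obtain \<Sigma> :: "'d \<Rightarrow> (real ^ 'd) set" where \<Sigma>: "\<And>i. lattice_simplex 1 (\<Sigma> i)"
      and iso: "cayley_isomorphic \<Delta> (cayley_polytope \<Sigma>)" by blast
    have "0 < k" "k < CARD('d)" if "k \<in> {1..d - 1}" for k using that assms(1,2) by auto
    then show "\<forall>k\<in>{1..d - 1}. interior ((\<lambda>x. real k *\<^sub>R x) ` \<Delta>) \<inter> integer_lattice = {}"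
      using hollow_dilate_if_cayley_isomorphic[OF iso lattice_simplex_nonempty[OF \<Sigma>]]
      by (simp add: hollow_def)
  qed (use ex_cayley_isomorphic_if_hollow_dilates[OF assms(2) W(3) basic] W(4) in
      \<open>simp add: hollow_def\<close>)
qed

end
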